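(* Let an oracle classification problem $(\mathcal F,\{A_j\}_{j\in\mathcal J},\{U_f\},\{p_f\})$ be given and fix $n\ge m$, where each $U_f$ acts on $m$ qubits. For every normalized $n$-qubit pure state $|\psi_1\rangle$, let $I_{\max}(|\psi_1\rangle)$ be the maximal value of $I(J;Y)$, over all unitaries $W$ on $n$ qubits, where $Y$ is the outcome of measuring $W(U_F\otimes I)|\psi_1\rangle$ in the computational basis. Then $$I_{\max}(|\psi_1\rangle)=\chi\bigl(\{p_j,\sigma_j^2\}_{j\in\mathcal J}\bigr)-D_Y(\rho^2_{JY}),$$ where $D_Y(\rho^2_{JY})=\min_\Pi D_Y(\rho^2_{JY};\Pi)$ is the quantum discord minimized over all projective measurements $\Pi$ of subsystem $Y$.
   Context: Oracle classification problem: a finite set $\mathcal F$; a partition $\mathcal F=\bigsqcup_{j\in\mathcal J}A_j$ into nonempty classes; a unitary $U_f$ on $m$ qubits for each $f$; and a probability distribution $p_f=\Pr(F=f)$. $J$ is the class of $F$; $p_j=\sum_{f\in A_j}p_f$, assumed positive. Given $F=f$, $\Pr(Y=y\mid F=f)=|\langle y|W(U_f\otimes I)|\psi_1\rangle|^2$ for $y\in\{0,1\}^n$. Define (the superscript 2 is a label, not a square) $$\sigma_j^2=\sum_{f\in A_j}\frac{p_f}{p_j}(U_f\otimes I)|\psi_1\rangle\langle\psi_1|(U_f\otimes I)^\dagger,\qquad \rho^2_{JY}=\sum_{j}p_j|j\rangle\langle j|\otimes\sigma_j^2$$ with $\{|j\rangle\}$ an orthonormal basis of $\mathbb C^{\mathcal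 J}$. The Holevo quantity is $\chi(\{p_j,\sigma_j\})=S(\sum_jp_j\sigma_j)-\sum_jp_jS(\sigma_j)$, with $S$ the von Neumann entropy; logarithms are base 2; $I(J;Y)$ is Shannon mutual information. For a projective measurement $\Pi=\{\Pi_k\}_k$ on $Y$ (orthogonal projections summing to the identity), $$D_Y(\rho_{JY};\Pi)=S(\rho_Y)-S(\rho_{JY})+\sum_kq_kS(\rho_J^k),$$ where $\rho_Y=\mathrm{Tr}_J\rho_{JY}$, $q_k=\mathrm{Tr}[(I\otimes\Pi_k)\rho_{JY}]$ and $\rho_J^k=\mathrm{Tr}_Y[(I\otimes\Pi_k)\rho_{JY}(I\otimes\Pi_k)]/q_k$ (terms with $q_k=0$ omitted). *)

theory Defs
  imports
    "HOL-Probability.Information"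
    "Jordan_Normal_Form.Schur_Decomposition"
    "Jordan_Normal_Form.Spectral_Radius"
begin

unbundle no vec_syntax

definition unitary_mat :: "nat \<Rightarrow> complex mat \<Rightarrow> bool" where
  "unitary_mat d U \<longleftrightarrow> U \<in> carrier_mat d d
     \<and> mat_adjoint U * U = 1\<^sub>m d \<and> U * mat_adjoint U = 1\<^sub>m d"

definition orthonormal_on :: "nat \<Rightarrow> 'i set \<Rightarrow> ('i \<Rightarrow> complex vec) \<Rightarrow> bool" where
  "orthonormal_on d I e \<longleftrightarrow> (\<forall>i\<in>I. e i \<in> carrier_vec d)
     \<and> (\<forall>i\<in>I. \<forall>k\<in>I. e i \<bullet>c e k = (if i = k then 1 else 0))"

definition pure_state :: "nat \<Rightarrow> complex vec \<Rightarrow> bool" where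
  "pure_state n \<psi> \<longleftrightarrow> \<psi> \<in> carrier_vec (2 ^ n) \<and> \<psi> \<bullet>c \<psi> = 1"

definition ketbra :: "complex vec \<Rightarrow> complex vec \<Rightarrow> complex mat" where
  "ketbra v w = Matrix.mat (dim_vec v) (dim_vec w) (\<lambda>(i, j). v $ i * cnj (w $ j))"

definition mat_trace :: "complex mat \<Rightarrow> complex" where
  "mat_trace M = (\<Sum>i<dim_row M. M $$ (i, i))"

text \<open>A sum of \<open>d\<close>-dimensional square matrices; the matrix type contains matrices of all
  dimensions and so has no zero for \<^const>\<open>sum\<close> to start from.\<close>

definition mat_sum :: "nat \<Rightarrow> 'i set \<Rightarrow> ('i \<Rightarrow> complex mat) \<Rightarrow> complex mat" where
  "mat_sum d I M = Matrix.mat d d (\<lambda>ij. \<Sum>x\<in>I. M x $$ ij)"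

text \<open>Kronecker product. The basis vector with indices \<open>i\<close> and \<open>k\<close> in factors of dimension
  \<open>a\<close> and \<open>b\<close> has index \<open>i * b + k\<close>; the partial traces follow the same convention.\<close>

definition tensor_mat :: "complex mat \<Rightarrow> complex mat \<Rightarrow> complex mat" where
  "tensor_mat M N = Matrix.mat (dim_row M * dim_row N) (dim_col M * dim_col N)
     (\<lambda>(i, j). M $$ (i div dim_row N, j div dim_col N) * N $$ (i mod dim_row N, j mod dim_col N))"

definition ptrace_left :: "nat \<Rightarrow> nat \<Rightarrow> complex mat \<Rightarrow> complex mat" where
  "ptrace_left a b M = Matrix.mat b b (\<lambda>(k, l). \<Sum>i<a. M $$ (i * b + k, i * b + l))"

definition ptrace_right :: "nat \<Rightarrow> nat \<Rightarrow> complex mat \<Rightarrow> complex mat" where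
  "ptrace_right a b M = Matrix.mat a a (\<lambda>(i, j). \<Sum>k<b. M $$ (i * b + k, j * b + k))"

text \<open>\<open>S(\<rho>) = - Tr (\<rho> log \<rho>)\<close>, that is, minus the sum of \<open>x log x\<close> over the eigenvalues \<open>x\<close> of
  \<open>\<rho>\<close> counted with multiplicity. The convention \<open>0 log 0 = 0\<close> comes from the factor \<open>x\<close>. Density
  matrices have real spectrum, so \<^const>\<open>Re\<close> is only a type conversion there.\<close>

definition vn_entropy :: "complex mat \<Rightarrow> real" where
  "vn_entropy \<rho> =
     - (\<Sum>x\<in>spectrum \<rho>. real (Polynomial.order x (char_poly \<rho>)) * (Re x * log 2 (Re x)))"

definition holevo :: "nat \<Rightarrow> 'j set \<Rightarrow> ('j \<Rightarrow> real) \<Rightarrow> ('j \<Rightarrow> complex mat) \<Rightarrow> real" where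
  "holevo d J q \<sigma> = vn_entropy (mat_sum d J (\<lambda>j. complex_of_real (q j) \<cdot>\<^sub>m \<sigma> j))
     - (\<Sum>j\<in>J. q j * vn_entropy (\<sigma> j))"

text \<open>The list holds the projections \<open>\<Pi>\<^sub>k\<close> for \<open>k < length Ps\<close>.\<close>

definition projective_measurement :: "nat \<Rightarrow> complex mat list \<Rightarrow> bool" where
  "projective_measurement d Ps \<longleftrightarrow>
     (\<forall>k<length Ps. Ps ! k \<in> carrier_mat d d \<and> mat_adjoint (Ps ! k) = Ps ! k)
     \<and> (\<forall>k<length Ps. \<forall>l<length Ps. Ps ! k * Ps ! l = (if k = l then Ps ! k else 0\<^sub>m d d))
     \<and> mat_sum d {..<length Ps} ((!) Ps) = 1\<^sub>m d"

text \<open>For the discord, \<open>\<rho>\<close> acts on a left factor \<open>J\<close> of dimension \<open>a\<close> and a right factor \<open>Y\<close>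
  of dimension \<open>b\<close>.\<close>

definition outcome_prob :: "nat \<Rightarrow> complex mat \<Rightarrow> complex mat \<Rightarrow> real" where
  "outcome_prob a \<rho> P = Re (mat_trace (tensor_mat (1\<^sub>m a) P * \<rho>))"

definition post_state :: "nat \<Rightarrow> nat \<Rightarrow> complex mat \<Rightarrow> complex mat \<Rightarrow> complex mat" where
  "post_state a b \<rho> P = complex_of_real (1 / outcome_prob a \<rho> P) \<cdot>\<^sub>m
     ptrace_right a b (tensor_mat (1\<^sub>m a) P * \<rho> * tensor_mat (1\<^sub>m a) P)"

definition discord_meas :: "nat \<Rightarrow> nat \<Rightarrow> complex mat \<Rightarrow> complex mat list \<Rightarrow> real" where
  "discord_meas a b \<rho> Ps = vn_entropy (ptrace_left a b \<rho>) - vn_entropy \<rho>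
     + (\<Sum>k\<in>{k. k < length Ps \<and> outcome_prob a \<rho> (Ps ! k) \<noteq> 0}.
          outcome_prob a \<rho> (Ps ! k) * vn_entropy (post_state a b \<rho> (Ps ! k)))"

definition discord :: "nat \<Rightarrow> nat \<Rightarrow> complex mat \<Rightarrow> real" where
  "discord a b \<rho> = (LEAST d. \<exists>Ps. projective_measurement b Ps \<and> d = discord_meas a b \<rho> Ps)"

text \<open>Finiteness of \<open>J\<close> follows, since the classes are disjoint, nonempty and contained in
  the finite set \<open>F\<close>.\<close>

locale oracle_classification =
  fixes F :: "'f set" and J :: "'j set" and A :: "'j \<Rightarrow> 'f set"
    and m :: nat and U :: "'f \<Rightarrow> complex mat" and p :: "'f \<Rightarrow> real"
  assumes finite_F: "finite F"
    and disjoint_classes: "disjoint_family_on A J"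
    and Union_classes: "(\<Union>j\<in>J. A j) = F"
    and class_nonempty: "\<And>j. j \<in> J \<Longrightarrow> A j \<noteq> {}"
    and unitary_U: "\<And>f. f \<in> F \<Longrightarrow> unitary_mat (2 ^ m) (U f)"
    and p_nonneg: "\<And>f. f \<in> F \<Longrightarrow> p f \<ge> 0"
    and sum_p: "(\<Sum>f\<in>F. p f) = 1"
    and class_prob_pos: "\<And>j. j \<in> J \<Longrightarrow> (\<Sum>f\<in>A j. p f) > 0"

definition class_index :: "'j set \<Rightarrow> ('j \<Rightarrow> 'f set) \<Rightarrow> 'f \<Rightarrow> 'j" where
  "class_index J A f = (THE j. j \<in> J \<and> f \<in> A j)"

definition class_prob :: "('j \<Rightarrow> 'f set) \<Rightarrow> ('f \<Rightarrow> real) \<Rightarrow> 'j \<Rightarrow> real" where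
  "class_prob A p j = (\<Sum>f\<in>A j. p f)"

definition query :: "nat \<Rightarrow> nat \<Rightarrow> ('f \<Rightarrow> complex mat) \<Rightarrow> 'f \<Rightarrow> complex mat" where
  "query n m U f = tensor_mat (U f) (1\<^sub>m (2 ^ (n - m)))"

text \<open>\<open>Pr(Y = y | F = f)\<close>. A bit string \<open>y\<close> of length \<open>n\<close> is represented by the number below
  \<open>2 ^ n\<close> of which it is the binary expansion. \<open>v \<bullet>c w\<close> is conjugate-linear in \<open>w\<close>.\<close>

definition cond_prob ::
    "nat \<Rightarrow> nat \<Rightarrow> ('f \<Rightarrow> complex mat) \<Rightarrow> complex vec \<Rightarrow> complex mat \<Rightarrow> 'f \<Rightarrow> nat \<Rightarrow> real" where
  "cond_prob n m U \<psi> W f y =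
     (cmod ((W *\<^sub>v (query n m U f *\<^sub>v \<psi>)) \<bullet>c unit_vec (2 ^ n) y))\<^sup>2"

definition joint_measure ::
    "'f set \<Rightarrow> nat \<Rightarrow> nat \<Rightarrow> ('f \<Rightarrow> complex mat) \<Rightarrow> ('f \<Rightarrow> real) \<Rightarrow> complex vec \<Rightarrow> complex mat
      \<Rightarrow> ('f \<times> nat) measure" where
  "joint_measure F n m U p \<psi> W = point_measure (F \<times> {..<2 ^ n})
     (\<lambda>(f, y). ennreal (p f * cond_prob n m U \<psi> W f y))"

text \<open>\<open>I(J;Y)\<close>, with \<open>F\<close> and \<open>Y\<close> the two coordinates of the sample space.\<close>

definition mutual_info ::
    "'f set \<Rightarrow> 'j set \<Rightarrow> ('j \<Rightarrow> 'f set) \<Rightarrow> nat \<Rightarrow> nat \<Rightarrow> ('f \<Rightarrow> complex mat) \<Rightarrow> ('f \<Rightarrow> real)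
      \<Rightarrow> complex vec \<Rightarrow> complex mat \<Rightarrow> real" where
  "mutual_info F J A n m U p \<psi> W =
     prob_space.mutual_information (joint_measure F n m U p \<psi> W) 2
       (count_space J) (count_space {..<2 ^ n}) (\<lambda>(f, y). class_index J A f) (\<lambda>(f, y). y)"

definition I_max ::
    "'f set \<Rightarrow> 'j set \<Rightarrow> ('j \<Rightarrow> 'f set) \<Rightarrow> nat \<Rightarrow> nat \<Rightarrow> ('f \<Rightarrow> complex mat) \<Rightarrow> ('f \<Rightarrow> real)
      \<Rightarrow> complex vec \<Rightarrow> real" where
  "I_max F J A n m U p \<psi> =
     (GREATEST i. \<exists>W. unitary_mat (2 ^ n) W \<and> i = mutual_info F J A n m U p \<psi> W)"

text \<open>\<open>\<sigma>\<^sub>j\<^sup>2\<close> and \<open>\<rho>\<^sup>2\<^sub>J\<^sub>Y\<close>, whose superscript is a label; \<open>ket\<close> is an orthonormal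
  basis indexed by \<open>J\<close>.\<close>

definition class_state ::
    "('j \<Rightarrow> 'f set) \<Rightarrow> nat \<Rightarrow> nat \<Rightarrow> ('f \<Rightarrow> complex mat) \<Rightarrow> ('f \<Rightarrow> real) \<Rightarrow> complex vec \<Rightarrow> 'j
      \<Rightarrow> complex mat" where
  "class_state A n m U p \<psi> j = mat_sum (2 ^ n) (A j)
     (\<lambda>f. complex_of_real (p f / class_prob A p j) \<cdot>\<^sub>m
            (query n m U f * ketbra \<psi> \<psi> * mat_adjoint (query n m U f)))"

definition joint_state ::
    "'j set \<Rightarrow> ('j \<Rightarrow> 'f set) \<Rightarrow> nat \<Rightarrow> nat \<Rightarrow> ('f \<Rightarrow> complex mat) \<Rightarrow> ('f \<Rightarrow> real) \<Rightarrow> complex vec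
      \<Rightarrow> ('j \<Rightarrow> complex vec) \<Rightarrow> complex mat" where
  "joint_state J A n m U p \<psi> ket = mat_sum (card J * 2 ^ n) J
     (\<lambda>j. complex_of_real (class_prob A p j) \<cdot>\<^sub>m
            tensor_mat (ketbra (ket j) (ket j)) (class_state A n m U p \<psi> j))"

end

(* For a measurement with effects P_k, let r(j,k) be the probability that J = j and the outcome is k.
   Since rho_JY is classical on J, S(rho_JY) = H(J) + sum_j p_j S(sigma_j) and rho_J^k is diagonal
   with entries r(j,k)/q_k; substituting, chi - D_Y(rho_JY; P) is the Shannon mutual information
   of r. A unitary W followed by the computational basis measurement is the rank-one projective
   measurement onto the vectors W^* |y>, so I(J;Y) <= chi - min D_Y. Conversely, an eigenbasis of
   sum_k k P_k refines a given projective measurement to a rank-one one, and coarse-graining the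
   outcome cannot increase mutual information. The maximum is attained because the mutual
   information is continuous on the compact set of unitaries. *)

theory Submission
  imports Defs "HOL-Real_Asymp.Real_Asymp"
begin

section \<open>Mutual information of a joint distribution\<close>

text \<open>Attainment is proved once, for \<open>W\<close>. Lists of projections may have any
  length, since zero projections are allowed, so the measurements offer no evident compact space.
  Instead, the measurement induced by an optimal \<open>W\<close> is shown to minimize the discord:
  any other measurement refines to some unitary \<open>V\<close>, and \<open>V\<close> cannot beat
  \<open>W\<close>. \<open>GREATEST\<close> and \<open>LEAST\<close> denote the intended values only
  when the extrema are attained, hence the two additional conjuncts of the theorem.

  Mutual information is written with quotients, whose continuity is unclear where a marginal
  vanishes. Splitting the logarithms turns it into sums of \<open>x log x\<close>, which is
  continuous on the nonnegative reals; this is also the form in which the entropies of the discord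
  cancel.

  Von Neumann entropy is defined through the characteristic polynomial, so every entropy is computed
  by exhibiting an orthonormal eigenbasis with real eigenvalues. Bases are indexed by arbitrary
  finite sets because the eigenbasis of rho_JY is naturally indexed by pairs of a class and an
  eigenvector of its state.\<close>

definition info :: "'j set \<Rightarrow> 'k set \<Rightarrow> ('j \<Rightarrow> 'k \<Rightarrow> real) \<Rightarrow> real" where
  "info J K r = (\<Sum>j\<in>J. \<Sum>k\<in>K. r j k * log 2 (r j k / ((\<Sum>l\<in>K. r j l) * (\<Sum>i\<in>J. r i k))))"

lemma info_cong:
  assumes "\<And>j k. j \<in> J \<Longrightarrow> k \<in> K \<Longrightarrow> r j k = s j k"
  shows "info J K r = info J K s"
  unfolding info_def using assms by (intro sum.cong) (simp_all cong: sum.cong)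

text \<open>Termwise \<open>ln x \<ge> 1 - 1/x\<close>, applied to \<open>x = r y * R / (q y * Q)\<close> with totals \<open>R\<close>, \<open>Q\<close>.\<close>

lemma log_sum_inequality:
  fixes r q :: "'a \<Rightarrow> real"
  assumes fin: "finite Y" and r: "\<And>y. y \<in> Y \<Longrightarrow> 0 \<le> r y" and q: "\<And>y. y \<in> Y \<Longrightarrow> 0 \<le> q y"
    and abs: "\<And>y. y \<in> Y \<Longrightarrow> q y = 0 \<Longrightarrow> r y = 0"
  shows "sum r Y * log 2 (sum r Y / sum q Y) \<le> (\<Sum>y\<in>Y. r y * log 2 (r y / q y))"
proof (cases "sum r Y = 0")
  case True
  then have "\<And>y. y \<in> Y \<Longrightarrow> r y = 0"
    using fin r by (simp add: sum_nonneg_eq_0_iff)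
  then show ?thesis by simp
next
  case False
  define R Q where "R = sum r Y" and "Q = sum q Y"
  have "0 \<le> sum r Y" by (intro sum_nonneg r)
  then have R: "R > 0" using False unfolding R_def by simp
  have "Q \<noteq> 0"
  proof
    assume "Q = 0"
    then have "\<And>y. y \<in> Y \<Longrightarrow> q y = 0" using fin q unfolding Q_def by (simp add: sum_nonneg_eq_0_iff)
    then show False using abs False by simp
  qed
  moreover have "Q \<ge> 0" unfolding Q_def by (intro sum_nonneg q)
  ultimately have Q: "Q > 0" by simp
  have le: "r y * ln (R / Q) + (r y - q y * R / Q) \<le> r y * ln (r y / q y)" if y: "y \<in> Y" for y
  proof (cases "r y = 0")
    case True
    then show ?thesis using q[OF y] R Q by simp
  next
    case False
    then have ry: "r y > 0" and qy: "q y > 0"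
      using r[OF y] q[OF y] abs[OF y] by fastforce+
    define z where "z = q y * R / (r y * Q)"
    have z: "z > 0" unfolding z_def using ry qy R Q by simp
    have "ln z \<le> z - 1" using z by (rule ln_le_minus_one)
    moreover have "ln z = ln (R / Q) - ln (r y / q y)"
      unfolding z_def using ry qy R Q by (simp add: ln_mult ln_div)
    ultimately have "r y * (ln (R / Q) - ln (r y / q y)) \<le> r y * (z - 1)"
      using ry by simp
    moreover have "r y * z = q y * R / Q" unfolding z_def using ry by simp
    ultimately show ?thesis by (simp add: algebra_simps)
  qed
  have "(\<Sum>y\<in>Y. r y * ln (R / Q) + (r y - q y * R / Q)) \<le> (\<Sum>y\<in>Y. r y * ln (r y / q y))"
    by (intro sum_mono le)
  \<comment> \<open>The linear corrections sum to \<open>R - Q * R / Q = 0\<close>; this is the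
    purpose of the factor \<open>R / Q\<close> in \<open>z\<close>.\<close>
  moreover have "(\<Sum>y\<in>Y. r y * ln (R / Q) + (r y - q y * R / Q)) = R * ln (R / Q) + (R - Q * R / Q)"
    unfolding R_def Q_def by (simp add: sum.distrib sum_subtractf sum_distrib_right sum_divide_distrib)
  ultimately have "R * ln (R / Q) \<le> (\<Sum>y\<in>Y. r y * ln (r y / q y))" using Q by simp
  then have "R * ln (R / Q) / ln 2 \<le> (\<Sum>y\<in>Y. r y * ln (r y / q y)) / ln 2"
    by (simp add: divide_right_mono)
  then show ?thesis
    unfolding R_def[symmetric] Q_def[symmetric] log_def by (simp add: sum_divide_distrib)
qed

text \<open>Data processing for a deterministic map \<open>g\<close>: for each \<open>j\<close>, the
  log-sum inequality is applied on every fibre of \<open>g\<close>, and the fibres are then summed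
  up. A label outside the image of \<open>g\<close> contributes an empty sum.\<close>

lemma info_coarse_le:
  assumes fin: "finite J" "finite Y" "finite K" and g: "g ` Y \<subseteq> K"
    and r: "\<And>j y. j \<in> J \<Longrightarrow> y \<in> Y \<Longrightarrow> 0 \<le> r j y"
  shows "info J K (\<lambda>j k. \<Sum>y\<in>{y\<in>Y. g y = k}. r j y) \<le> info J Y r"
proof -
  have *: "(\<Sum>k\<in>K. (\<Sum>y\<in>{y\<in>Y. g y = k}. r j y)
        * log 2 ((\<Sum>y\<in>{y\<in>Y. g y = k}. r j y)
           / ((\<Sum>l\<in>K. \<Sum>y\<in>{y\<in>Y. g y = l}. r j y) * (\<Sum>i\<in>J. \<Sum>y\<in>{y\<in>Y. g y = k}. r i y))))
      \<le> (\<Sum>y\<in>Y. r j y * log 2 (r j y / ((\<Sum>l\<in>Y. r j l) * (\<Sum>i\<in>J. r i y))))"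
    if j: "j \<in> J" for j
  proof -
    define P where "P = (\<Sum>l\<in>Y. r j l)"
    have P: "(\<Sum>l\<in>K. \<Sum>y\<in>{y\<in>Y. g y = l}. r j y) = P"
      unfolding P_def using sum.group[OF fin(2,3) g] .
    have "(\<Sum>k\<in>K. (\<Sum>y\<in>{y\<in>Y. g y = k}. r j y)
        * log 2 ((\<Sum>y\<in>{y\<in>Y. g y = k}. r j y)
           / (P * (\<Sum>i\<in>J. \<Sum>y\<in>{y\<in>Y. g y = k}. r i y))))
      \<le> (\<Sum>k\<in>K. \<Sum>y\<in>{y\<in>Y. g y = k}. r j y * log 2 (r j y / (P * (\<Sum>i\<in>J. r i y))))"
    proof (intro sum_mono)
      fix k
      let ?q = "\<lambda>y. P * (\<Sum>i\<in>J. r i y)"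
      have P0: "P \<ge> 0" unfolding P_def using j r by (intro sum_nonneg) auto
      \<comment> \<open>The factor \<open>P\<close> is common to the whole fibre, so the coarse
        denominator is exactly the sum of the fine ones, as the log-sum inequality requires.\<close>
      have eq: "P * (\<Sum>i\<in>J. \<Sum>y\<in>{y\<in>Y. g y = k}. r i y) = sum ?q {y\<in>Y. g y = k}"
        by (subst sum.swap) (simp add: sum_distrib_left)
      show "(\<Sum>y\<in>{y\<in>Y. g y = k}. r j y)
        * log 2 ((\<Sum>y\<in>{y\<in>Y. g y = k}. r j y)
           / (P * (\<Sum>i\<in>J. \<Sum>y\<in>{y\<in>Y. g y = k}. r i y)))
         \<le> (\<Sum>y\<in>{y\<in>Y. g y = k}. r j y * log 2 (r j y / ?q y))"
        unfolding eq
      proof (rule log_sum_inequality)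
        fix y assume "y \<in> {y\<in>Y. g y = k}"
        then have y: "y \<in> Y" by simp
        show "0 \<le> r j y" using r j y by simp
        show "0 \<le> ?q y" using P0 r y by (simp add: sum_nonneg)
        \<comment> \<open>Absolute continuity: one of the two marginals vanishes, and
          \<open>r j y\<close> is a nonnegative term of both.\<close>
        assume "?q y = 0"
        then have "P = 0 \<or> (\<Sum>i\<in>J. r i y) = 0" by simp
        then show "r j y = 0"
          unfolding P_def using fin r j y by (auto simp: sum_nonneg_eq_0_iff)
      qed (use fin in simp)
    qed
    also have "\<dots> = (\<Sum>y\<in>Y. r j y * log 2 (r j y / (P * (\<Sum>i\<in>J. r i y))))"
      using sum.group[OF fin(2,3) g] .
    finally show ?thesis unfolding P P_def[symmetric] .
  qed
  show ?thesis unfolding info_def by (intro sum_mono *)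
qed

section \<open>Entropy form and continuity of mutual information\<close>

lemma continuous_on_x_log_x: "continuous_on {0..} (\<lambda>x::real. x * log 2 x)"
proof (clarsimp simp: continuous_on_eq_continuous_within)
  fix x :: real assume x: "0 \<le> x"
  show "continuous (at x within {0..}) (\<lambda>x. x * log 2 x)"
  proof (cases "x = 0")
    case True
    \<comment> \<open>The limit agrees with the value at \<open>0\<close>, where the factor
      \<open>x\<close> gives \<open>0\<close> whatever \<open>log 2 0\<close> is.\<close>
    have "((\<lambda>x::real. x * log 2 x) \<longlongrightarrow> 0) (at_right 0)" by real_asymp
    then have "((\<lambda>x::real. x * log 2 x) \<longlongrightarrow> 0) (at 0 within {0..})"
      by (simp add: at_within_Ici_at_right)
    then show ?thesis using True by (simp add: continuous_within)
  next
    case False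
    then have "isCont (\<lambda>x. x * log 2 x) x" using x by (intro continuous_intros) auto
    then show ?thesis by (rule continuous_at_imp_continuous_within)
  qed
qed

text \<open>The identity \<open>I = H(J) + H(K) - H(J,K)\<close> with the entropies written out. A
  positive entry has positive row and column totals, so its logarithm splits; for a zero entry every
  term vanishes.\<close>

lemma info_eq_entropies:
  assumes fin: "finite J" "finite K" and r: "\<And>j k. j \<in> J \<Longrightarrow> k \<in> K \<Longrightarrow> 0 \<le> r j k"
  shows "info J K r = (\<Sum>j\<in>J. \<Sum>k\<in>K. r j k * log 2 (r j k))
    - (\<Sum>j\<in>J. (\<Sum>k\<in>K. r j k) * log 2 (\<Sum>k\<in>K. r j k))
    - (\<Sum>k\<in>K. (\<Sum>j\<in>J. r j k) * log 2 (\<Sum>j\<in>J. r j k))"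
proof -
  have *: "r j k * log 2 (r j k / ((\<Sum>l\<in>K. r j l) * (\<Sum>i\<in>J. r i k)))
      = r j k * log 2 (r j k) - r j k * log 2 (\<Sum>l\<in>K. r j l) - r j k * log 2 (\<Sum>i\<in>J. r i k)"
    if jk: "j \<in> J" "k \<in> K" for j k
  proof (cases "r j k = 0")
    case False
    then have p: "r j k > 0" using r[OF jk] by simp
    have "r j k \<le> (\<Sum>l\<in>K. r j l)" using fin jk r by (intro member_le_sum) auto
    moreover have "r j k \<le> (\<Sum>i\<in>J. r i k)" using fin jk r by (intro member_le_sum) auto
    ultimately show ?thesis using p by (simp add: log_divide log_mult algebra_simps)
  qed simp
  have "info J K r = (\<Sum>j\<in>J. \<Sum>k\<in>K. r j k * log 2 (r j k))
    - (\<Sum>j\<in>J. \<Sum>k\<in>K. r j k * log 2 (\<Sum>l\<in>K. r j l))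
    - (\<Sum>j\<in>J. \<Sum>k\<in>K. r j k * log 2 (\<Sum>i\<in>J. r i k))"
    unfolding info_def by (simp add: * sum_subtractf cong: sum.cong)
  also have "(\<Sum>j\<in>J. \<Sum>k\<in>K. r j k * log 2 (\<Sum>i\<in>J. r i k)) = (\<Sum>k\<in>K. \<Sum>j\<in>J. r j k * log 2 (\<Sum>i\<in>J. r i k))"
    by (rule sum.swap)
  finally show ?thesis by (simp add: sum_distrib_right)
qed

lemma continuous_on_info:
  assumes fin: "finite J" "finite K" and r: "\<And>j k x. j \<in> J \<Longrightarrow> k \<in> K \<Longrightarrow> x \<in> X \<Longrightarrow> 0 \<le> r x j k"
    and cont: "\<And>j k. j \<in> J \<Longrightarrow> k \<in> K \<Longrightarrow> continuous_on X (\<lambda>x. r x j k)"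
  shows "continuous_on X (\<lambda>x. info J K (r x))"
proof -
  have h: "continuous_on X (\<lambda>x. f x * log 2 (f x))"
    if "continuous_on X f" "\<And>x. x \<in> X \<Longrightarrow> 0 \<le> f x" for f
    by (rule continuous_on_compose2[OF continuous_on_x_log_x that(1)]) (use that(2) in auto)
  have "continuous_on X (\<lambda>x. (\<Sum>j\<in>J. \<Sum>k\<in>K. r x j k * log 2 (r x j k))
    - (\<Sum>j\<in>J. (\<Sum>k\<in>K. r x j k) * log 2 (\<Sum>k\<in>K. r x j k))
    - (\<Sum>k\<in>K. (\<Sum>j\<in>J. r x j k) * log 2 (\<Sum>j\<in>J. r x j k)))"
    by (intro continuous_on_diff continuous_on_sum h cont r sum_nonneg)
  then show ?thesis
    by (rule continuous_on_eq) (rule info_eq_entropies[symmetric], use fin r in auto)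
qed

section \<open>Orthonormal bases and the spectral theorem\<close>

lemma cscalar_prod_sum: "w \<in> carrier_vec d \<Longrightarrow> v \<bullet>c w = (\<Sum>i<d. v $ i * cnj (w $ i))"
  by (auto simp: scalar_prod_def atLeast0LessThan intro!: sum.cong)

lemma mult_mat_index:
  assumes "M \<in> carrier_mat a b" "N \<in> carrier_mat b c" "i < a" "j < c"
  shows "(M * N) $$ (i, j) = (\<Sum>k<b. M $$ (i, k) * N $$ (k, j))"
  using assms by (auto simp: scalar_prod_def atLeast0LessThan intro!: sum.cong)

lemma mult_mat_vec_index:
  assumes "M \<in> carrier_mat a b" "v \<in> carrier_vec b" "i < a"
  shows "(M *\<^sub>v v) $ i = (\<Sum>k<b. M $$ (i, k) * v $ k)"
  using assms by (auto simp: scalar_prod_def atLeast0LessThan intro!: sum.cong)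

text \<open>These rules would turn entries of products into scalar products of rows and columns;
  from here on such entries are expanded into explicit sums by \<open>mult_mat_index\<close> and
  \<open>mult_mat_vec_index\<close>.\<close>

declare index_mult_mat(1) [simp del] index_mult_mat_vec [simp del]

lemma mat_adjoint_carrier [simp]: "M \<in> carrier_mat a b \<Longrightarrow> mat_adjoint M \<in> carrier_mat b a"
  by (auto simp: mat_adjoint_def)

lemma mat_adjoint_index:
  assumes "M \<in> carrier_mat a b" "i < b" "j < a"
  shows "mat_adjoint M $$ (i, j) = cnj (M $$ (j, i))"
  using assms by (auto simp: mat_adjoint_def mat_of_rows_def)

lemma cscalar_prod_swap:
  assumes "v \<in> carrier_vec d" "w \<in> carrier_vec d"
  shows "w \<bullet>c v = cnj (v \<bullet>c w)"
  using assms by (simp add: cscalar_prod_sum mult.commute)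

lemma cscalar_prod_self:
  assumes "v \<in> carrier_vec d"
  shows "v \<bullet>c v = complex_of_real (\<Sum>i<d. (cmod (v $ i))\<^sup>2)"
  using assms by (simp add: cscalar_prod_sum complex_norm_square[symmetric])

lemma cscalar_prod_adjoint:
  fixes M :: "complex mat"
  assumes M: "M \<in> carrier_mat a b" and v: "v \<in> carrier_vec b" and w: "w \<in> carrier_vec a"
  shows "(M *\<^sub>v v) \<bullet>c w = v \<bullet>c (mat_adjoint M *\<^sub>v w)"
proof -
  have "(M *\<^sub>v v) \<bullet>c w = (\<Sum>i<a. \<Sum>k<b. M $$ (i, k) * v $ k * cnj (w $ i))"
    using assms by (simp add: cscalar_prod_sum[OF w] mult_mat_vec_index[OF M v] sum_distrib_right)
  also have "\<dots> = (\<Sum>k<b. \<Sum>i<a. M $$ (i, k) * v $ k * cnj (w $ i))" by (rule sum.swap)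
  also have "\<dots> = (\<Sum>k<b. v $ k * cnj ((mat_adjoint M *\<^sub>v w) $ k))"
    using M w by (simp add: mult_mat_vec_index[OF mat_adjoint_carrier[OF M] w] mat_adjoint_index[OF M]
        sum_distrib_left algebra_simps)
  also have "\<dots> = v \<bullet>c (mat_adjoint M *\<^sub>v w)"
    by (intro cscalar_prod_sum[symmetric] mult_mat_vec_carrier[OF mat_adjoint_carrier[OF M] w])
  finally show ?thesis .
qed

lemma mat_sum_carrier [simp]: "mat_sum d I M \<in> carrier_mat d d"
  by (simp add: mat_sum_def)

lemma mat_sum_index: "i < d \<Longrightarrow> j < d \<Longrightarrow> mat_sum d I M $$ (i, j) = (\<Sum>x\<in>I. M x $$ (i, j))"
  by (simp add: mat_sum_def)

lemma mat_sum_mult_vec_index: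
  assumes M: "\<And>x. x \<in> I \<Longrightarrow> M x \<in> carrier_mat d d" and v: "v \<in> carrier_vec d" and i: "i < d"
  shows "(mat_sum d I M *\<^sub>v v) $ i = (\<Sum>x\<in>I. (M x *\<^sub>v v) $ i)"
proof -
  have "(mat_sum d I M *\<^sub>v v) $ i = (\<Sum>k<d. \<Sum>x\<in>I. M x $$ (i, k) * v $ k)"
    using v i by (simp add: mult_mat_vec_index[OF mat_sum_carrier v] mat_sum_index sum_distrib_right)
  also have "\<dots> = (\<Sum>x\<in>I. \<Sum>k<d. M x $$ (i, k) * v $ k)" by (rule sum.swap)
  also have "\<dots> = (\<Sum>x\<in>I. (M x *\<^sub>v v) $ i)"
    by (intro sum.cong refl mult_mat_vec_index[OF _ v i, symmetric] M)
  finally show ?thesis .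
qed

text \<open>The basis vectors become the columns of \<open>V\<close>, in the order of an enumeration
  \<open>b\<close> of the index set. Orthonormality says that the adjoint is a left inverse; for
  square matrices it is then also a right inverse, and this second equation is completeness.\<close>

lemma onb_matrix:
  assumes e: "orthonormal_on d I e" and fin: "finite I" and card: "card I = d"
  obtains b V where "bij_betw b {..<d} I" "V \<in> carrier_mat d d"
    "\<forall>i<d. \<forall>c<d. V $$ (i, c) = e (b c) $ i"
    "mat_adjoint V * V = 1\<^sub>m d" "V * mat_adjoint V = 1\<^sub>m d"
proof -
  obtain b where b: "bij_betw b {..<d} I"
    using ex_bij_betw_nat_finite[OF fin] card by (auto simp: atLeast0LessThan)
  have bI: "b i \<in> I" if "i < d" for i using b that by (auto simp: bij_betw_def)
  have binj: "b i = b k \<longleftrightarrow> i = k" if "i < d" "k < d" for i k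
    using b that by (auto simp: bij_betw_def inj_on_def)
  have ec: "e (b i) \<in> carrier_vec d" if "i < d" for i using e bI[OF that] by (simp add: orthonormal_on_def)
  define V where "V = Matrix.mat d d (\<lambda>(i, c). e (b c) $ i)"
  have V: "V \<in> carrier_mat d d" by (simp add: V_def)
  have Vi: "V $$ (i, c) = e (b c) $ i" if "i < d" "c < d" for i c using that by (simp add: V_def)
  have "mat_adjoint V * V = 1\<^sub>m d"
  proof (rule eq_matI)
    fix i j assume "i < dim_row (1\<^sub>m d :: complex mat)" "j < dim_col (1\<^sub>m d :: complex mat)"
    then have ij: "i < d" "j < d" by auto
    have "(mat_adjoint V * V) $$ (i, j) = (\<Sum>k<d. cnj (V $$ (k, i)) * V $$ (k, j))"
      using ij by (simp add: mult_mat_index[OF mat_adjoint_carrier[OF V] V] mat_adjoint_index[OF V])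
    also have "\<dots> = e (b j) \<bullet>c e (b i)"
      using ij by (simp add: Vi cscalar_prod_sum[OF ec] mult.commute)
    also have "\<dots> = (1\<^sub>m d) $$ (i, j)"
      using e bI binj ij by (auto simp: orthonormal_on_def)
    finally show "(mat_adjoint V * V) $$ (i, j) = (1\<^sub>m d) $$ (i, j)" .
  qed (use V in \<open>auto simp: mat_adjoint_def\<close>)
  moreover from this have "V * mat_adjoint V = 1\<^sub>m d"
    by (rule mat_mult_left_right_inverse[OF mat_adjoint_carrier[OF V] V])
  ultimately show ?thesis using that[OF b V] Vi by simp
qed

lemma orthonormal_on_completeness:
  assumes e: "orthonormal_on d I e" and fin: "finite I" and card: "card I = d"
    and r: "r < d" and s: "s < d"
  shows "(\<Sum>i\<in>I. e i $ r * cnj (e i $ s)) = (if r = s then 1 else 0)"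
proof -
  obtain b V where b: "bij_betw b {..<d} I" and V: "V \<in> carrier_mat d d"
    and Vi: "\<forall>i<d. \<forall>c<d. V $$ (i, c) = e (b c) $ i"
    and "mat_adjoint V * V = 1\<^sub>m d" and VV: "V * mat_adjoint V = 1\<^sub>m d"
    by (rule onb_matrix[OF e fin card])
  have "(\<Sum>i\<in>I. e i $ r * cnj (e i $ s)) = (\<Sum>c<d. e (b c) $ r * cnj (e (b c) $ s))"
    using sum.reindex_bij_betw[OF b, of "\<lambda>i. e i $ r * cnj (e i $ s)"] by simp
  also have "\<dots> = (V * mat_adjoint V) $$ (r, s)"
    using r s by (simp add: mult_mat_index[OF V mat_adjoint_carrier[OF V]] mat_adjoint_index[OF V] Vi)
  finally show ?thesis using VV r s by simp
qed

text \<open>After exchanging the sums, the basis occurs only in its completeness relation, which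
  collapses the double sum to the diagonal.\<close>

lemma parseval:
  assumes e: "orthonormal_on d I e" and fin: "finite I" and card: "card I = d"
    and x: "x \<in> carrier_vec d" and z: "z \<in> carrier_vec d"
  shows "x \<bullet>c z = (\<Sum>i\<in>I. (x \<bullet>c e i) * (e i \<bullet>c z))"
proof -
  have ec: "e i \<in> carrier_vec d" if "i \<in> I" for i using e that by (simp add: orthonormal_on_def)
  have "(\<Sum>i\<in>I. (x \<bullet>c e i) * (e i \<bullet>c z))
      = (\<Sum>i\<in>I. \<Sum>s<d. \<Sum>r<d. x $ s * cnj (z $ r) * (e i $ r * cnj (e i $ s)))"
    using z by (intro sum.cong)
      (simp_all add: cscalar_prod_sum[OF z] cscalar_prod_sum[OF ec] sum_product algebra_simps)
  also have "\<dots> = (\<Sum>s<d. \<Sum>r<d. x $ s * cnj (z $ r) * (\<Sum>i\<in>I. e i $ r * cnj (e i $ s)))"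
    by (subst sum.swap, rule sum.cong[OF refl], subst sum.swap) (simp add: sum_distrib_left)
  also have "\<dots> = (\<Sum>s<d. \<Sum>r<d. x $ s * cnj (z $ r) * (if r = s then 1 else 0))"
    by (intro sum.cong refl) (simp add: orthonormal_on_completeness[OF e fin card])
  also have "\<dots> = (\<Sum>s<d. x $ s * cnj (z $ s))"
    by (intro sum.cong refl) (simp add: sum.delta' if_distrib[of "(*) _"] cong: if_cong)
  finally show ?thesis by (simp add: cscalar_prod_sum[OF z])
qed

lemma cscalar_prod_unit_vec:
  fixes v :: "complex vec"
  assumes "v \<in> carrier_vec d" "r < d"
  shows "v \<bullet>c unit_vec d r = v $ r"
proof -
  have "v \<bullet>c unit_vec d r = (\<Sum>i<d. if i = r then v $ i else 0)"
    using assms unfolding cscalar_prod_sum[OF unit_vec_carrier] by (intro sum.cong) auto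
  then show ?thesis using assms by simp
qed

lemma onb_expansion:
  assumes e: "orthonormal_on d I e" and fin: "finite I" and card: "card I = d"
    and x: "x \<in> carrier_vec d" and r: "r < d"
  shows "x $ r = (\<Sum>i\<in>I. (x \<bullet>c e i) * e i $ r)"
proof -
  have "e i \<in> carrier_vec d" if "i \<in> I" for i using e that by (simp add: orthonormal_on_def)
  then show ?thesis
    using parseval[OF e fin card x unit_vec_carrier, of r] x r by (simp add: cscalar_prod_unit_vec)
qed

lemma cscalar_prod_smult:
  "v \<in> carrier_vec d \<Longrightarrow> w \<in> carrier_vec d \<Longrightarrow> (c \<cdot>\<^sub>v v) \<bullet>c w = c * (v \<bullet>c w)"
  by (simp add: cscalar_prod_sum sum_distrib_left mult.assoc)

lemma exists_normalized:
  assumes u: "u \<in> carrier_vec d" "u \<noteq> 0\<^sub>v d"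
  obtains c where "(c \<cdot>\<^sub>v u) \<bullet>c (c \<cdot>\<^sub>v u) = (1 :: complex)"
proof -
  define N where "N = sqrt (\<Sum>i<d. (cmod (u $ i))\<^sup>2)"
  have "N \<noteq> 0"
  proof
    assume "N = 0"
    then have "\<forall>i<d. u $ i = 0" unfolding N_def by (simp add: sum_nonneg_eq_0_iff)
    then have "u = 0\<^sub>v d" using u(1) by (intro eq_vecI) auto
    then show False using u by simp
  qed
  have N: "u \<bullet>c u = complex_of_real (N\<^sup>2)"
    unfolding N_def by (simp add: cscalar_prod_self[OF u(1)] sum_nonneg)
  let ?v = "complex_of_real (1 / N) \<cdot>\<^sub>v u"
  have "?v \<bullet>c ?v = complex_of_real (1 / N) * complex_of_real (1 / N) * (u \<bullet>c u)"
    using u(1) by (simp add: cscalar_prod_sum[of _ d] sum_distrib_left algebra_simps)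
  then have "?v \<bullet>c ?v = 1" using \<open>N \<noteq> 0\<close> N by (simp add: power2_eq_square)
  then show ?thesis by (rule that)
qed

text \<open>Orthogonality to fewer than \<open>d\<close> vectors is a singular square linear system
  once zero rows are added; a nonzero kernel vector, normalized, is the desired one.\<close>

lemma exists_orthogonal_unit_vec:
  assumes e: "orthonormal_on d {..<k} e" and k: "k < d"
  obtains v where "v \<in> carrier_vec d" "v \<bullet>c v = 1" "\<And>i. i < k \<Longrightarrow> v \<bullet>c e i = 0"
proof -
  \<comment> \<open>The rows below \<open>k\<close> express orthogonality to \<open>e i\<close>; the
    outer case distinction on \<open>i = k\<close> gives the zero row in the shape that
    \<open>det_row_0\<close> expects.\<close>
  define M where "M = mat\<^sub>r d d (\<lambda>i. if i = k then 0\<^sub>v d else if i < k then conjugate (e i) else 0\<^sub>v d)"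
  have M: "M \<in> carrier_mat d d" by (simp add: M_def)
  have ec: "e i \<in> carrier_vec d" if "i < k" for i using e that by (simp add: orthonormal_on_def)
  have "Determinant.det M = 0" unfolding M_def using k ec by (intro det_row_0) auto
  then obtain u where u: "u \<in> carrier_vec d" "u \<noteq> 0\<^sub>v d" "M *\<^sub>v u = 0\<^sub>v d"
    using det_0_iff_vec_prod_zero_field[OF M] by blast
  have orth: "u \<bullet>c e i = 0" if i: "i < k" for i
  proof -
    have "0 = (M *\<^sub>v u) $ i" using u i k by simp
    also have "\<dots> = (\<Sum>l<d. cnj (e i $ l) * u $ l)"
      unfolding mult_mat_vec_index[OF M u(1) less_trans[OF i k]]
      using i k ec[OF i] by (intro sum.cong) (auto simp: M_def)
    also have "\<dots> = u \<bullet>c e i" by (simp add: cscalar_prod_sum[OF ec[OF i]] mult.commute)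
    finally show ?thesis by simp
  qed
  obtain c where c: "(c \<cdot>\<^sub>v u) \<bullet>c (c \<cdot>\<^sub>v u) = 1" by (rule exists_normalized[OF u(1,2)])
  show ?thesis
    using that[of "c \<cdot>\<^sub>v u"] c u(1) orth ec by (simp add: cscalar_prod_smult)
qed

lemma orthonormal_on_insert:
  assumes e: "orthonormal_on d {..<k} e" and v: "v \<in> carrier_vec d" "v \<bullet>c v = 1"
    and orth: "\<And>i. i < k \<Longrightarrow> v \<bullet>c e i = 0"
  shows "orthonormal_on d {..<Suc k} (e(k := v))"
proof -
  have "e i \<bullet>c v = 0" if "i < k" for i
    using cscalar_prod_swap[of v d "e i"] orth[OF that] v e that by (simp add: orthonormal_on_def)
  then show ?thesis using e v orth by (auto simp: orthonormal_on_def less_Suc_eq)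
qed

lemma orthonormal_on_extend:
  assumes "k \<le> l" "l \<le> d" "orthonormal_on d {..<k} e"
  shows "\<exists>e'. orthonormal_on d {..<l} e' \<and> (\<forall>i<k. e' i = e i)"
  using assms
proof (induction l rule: dec_induct)
  case base
  then show ?case by blast
next
  case (step l)
  then obtain e' where e': "orthonormal_on d {..<l} e'" "\<forall>i<k. e' i = e i" by auto
  obtain v where "v \<in> carrier_vec d" "v \<bullet>c v = 1" "\<And>i. i < l \<Longrightarrow> v \<bullet>c e' i = 0"
    using exists_orthogonal_unit_vec[OF e'(1)] step by (auto simp: Suc_le_eq)
  then have "orthonormal_on d {..<Suc l} (e'(l := v))" by (intro orthonormal_on_insert e'(1)) auto
  moreover have "\<forall>i<k. (e'(l := v)) i = e i" using e'(2) step(1) by auto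
  ultimately show ?case by blast
qed

lemma parseval_norm:
  assumes e: "orthonormal_on d {..<d} e" and x: "x \<in> carrier_vec d"
  shows "(\<Sum>k<d. (cmod (x \<bullet>c e k))\<^sup>2) = Re (x \<bullet>c x)"
proof -
  have "x \<bullet>c x = (\<Sum>k<d. complex_of_real ((cmod (x \<bullet>c e k))\<^sup>2))"
    unfolding parseval[OF e finite_lessThan card_lessThan x x]
  proof (intro sum.cong refl)
    fix k assume "k \<in> {..<d}"
    then have "e k \<in> carrier_vec d" using e by (simp add: orthonormal_on_def)
    then have "e k \<bullet>c x = cnj (x \<bullet>c e k)" by (rule cscalar_prod_swap[OF x])
    then show "(x \<bullet>c e k) * (e k \<bullet>c x) = complex_of_real ((cmod (x \<bullet>c e k))\<^sup>2)"
      by (simp only: complex_norm_square)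
  qed
  then show ?thesis by simp
qed

section \<open>Von Neumann entropy from an orthonormal eigenbasis\<close>

lemma order_prod_linear:
  fixes a :: "'i \<Rightarrow> complex"
  assumes "finite I"
  shows "Polynomial.order x (\<Prod>i\<in>I. [:- a i, 1:]) = card {i\<in>I. a i = x}"
  using assms
proof (induction I rule: finite_induct)
  case empty
  then show ?case by (simp add: order_0I)
next
  case (insert i I)
  have nz: "[:- a i, 1:] * (\<Prod>i\<in>I. [:- a i, 1:]) \<noteq> 0"
    unfolding mult_eq_0_iff using insert(1) by (simp add: prod_zero_iff)
  have lin: "Polynomial.order x [:- a i, 1:] = (if a i = x then 1 else 0)"
  proof (cases "a i = x")
    case True
    then show ?thesis using order_power_n_n[of x 1] by simp
  next
    case False
    then show ?thesis by (simp add: order_0I)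
  qed
  have "Polynomial.order x (\<Prod>i\<in>insert i I. [:- a i, 1:])
      = Polynomial.order x [:- a i, 1:] + card {i\<in>I. a i = x}"
    unfolding prod.insert[OF insert(1,2)] order_mult[OF nz] insert.IH ..
  moreover have "{k \<in> insert i I. a k = x} = (if a i = x then insert i {k\<in>I. a k = x} else {k\<in>I. a k = x})"
    by auto
  ultimately show ?case using insert(1,2) by (simp add: lin)
qed

text \<open>The definition sums over distinct eigenvalues with their multiplicities. The
  multiplicity of \<open>x\<close> is the number of indices \<open>i\<close> with
  \<open>l i = x\<close>, so the sum over \<open>I\<close>, where values may repeat, is regrouped by
  value.\<close>

lemma vn_entropy_char_poly:
  fixes l :: "'i \<Rightarrow> real"
  assumes M: "M \<in> carrier_mat d d" and fin: "finite I"
    and cp: "char_poly M = (\<Prod>i\<in>I. [:- complex_of_real (l i), 1:])"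
  shows "vn_entropy M = - (\<Sum>i\<in>I. l i * log 2 (l i))"
proof -
  let ?a = "\<lambda>i. complex_of_real (l i)"
  have sp: "spectrum M = ?a ` I"
    unfolding spectrum_root_char_poly[OF M] cp using fin by (auto simp: poly_prod)
  have "(\<Sum>x\<in>?a ` I. real (Polynomial.order x (char_poly M)) * (Re x * log 2 (Re x)))
      = (\<Sum>x\<in>?a ` I. \<Sum>i\<in>{i\<in>I. ?a i = x}. l i * log 2 (l i))"
  proof (intro sum.cong refl)
    fix x
    have "(\<Sum>i\<in>{i\<in>I. ?a i = x}. l i * log 2 (l i)) = (\<Sum>i\<in>{i\<in>I. ?a i = x}. Re x * log 2 (Re x))"
      by (intro sum.cong) auto
    then show "real (Polynomial.order x (char_poly M)) * (Re x * log 2 (Re x))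
        = (\<Sum>i\<in>{i\<in>I. ?a i = x}. l i * log 2 (l i))"
      unfolding cp order_prod_linear[OF fin] by simp
  qed
  also have "\<dots> = (\<Sum>i\<in>I. l i * log 2 (l i))"
    by (rule sum.image_gen[OF fin, symmetric])
  finally show ?thesis unfolding vn_entropy_def sp by simp
qed

text \<open>The unitary with columns \<open>e i\<close> conjugates \<open>M\<close> into the
  diagonal matrix of the \<open>a i\<close>, and similar matrices have the same characteristic
  polynomial.\<close>

lemma char_poly_eigenbasis:
  fixes M :: "complex mat"
  assumes M: "M \<in> carrier_mat d d" and e: "orthonormal_on d I e" and fin: "finite I" and card: "card I = d"
    and ev: "\<And>i. i \<in> I \<Longrightarrow> M *\<^sub>v e i = a i \<cdot>\<^sub>v e i"
  shows "char_poly M = (\<Prod>i\<in>I. [:- a i, 1:])"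
proof -
  obtain b V where b: "bij_betw b {..<d} I" and V: "V \<in> carrier_mat d d"
    and Vi: "\<forall>i<d. \<forall>c<d. V $$ (i, c) = e (b c) $ i"
    and VV: "mat_adjoint V * V = 1\<^sub>m d" "V * mat_adjoint V = 1\<^sub>m d"
    by (rule onb_matrix[OF e fin card])
  have bI: "b i \<in> I" if "i < d" for i using b that by (auto simp: bij_betw_def)
  have ec: "e (b i) \<in> carrier_vec d" if "i < d" for i using e bI[OF that] by (simp add: orthonormal_on_def)
  define D where "D = Matrix.mat d d (\<lambda>(i, j). if i = j then a (b i) else 0)"
  have D: "D \<in> carrier_mat d d" by (simp add: D_def)
  have MV: "M * V = V * D"
  proof (rule eq_matI)
    fix i j assume "i < dim_row (V * D)" "j < dim_col (V * D)"
    then have ij: "i < d" "j < d" using V D by auto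
    have "(M * V) $$ (i, j) = (M *\<^sub>v e (b j)) $ i"
      using ij by (simp add: mult_mat_index[OF M V] mult_mat_vec_index[OF M ec] Vi)
    also have "\<dots> = V $$ (i, j) * a (b j)"
      using ij ev[OF bI] ec[of j] by (simp add: Vi)
    also have "\<dots> = (\<Sum>k<d. if k = j then V $$ (i, k) * a (b k) else 0)"
      using ij by simp
    also have "\<dots> = (V * D) $$ (i, j)"
      unfolding mult_mat_index[OF V D ij] using ij by (intro sum.cong) (auto simp: D_def)
    finally show "(M * V) $$ (i, j) = (V * D) $$ (i, j)" .
  qed (use M V D in auto)
  have Va: "mat_adjoint V \<in> carrier_mat d d" using V by simp
  have "M = M * (V * mat_adjoint V)" using VV M by simp
  also have "\<dots> = V * D * mat_adjoint V" using assoc_mult_mat[OF M V Va] MV by simp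
  finally have MD: "M = V * D * mat_adjoint V" .
  have "similar_mat M D" by (rule similar_matI[OF _ VV(2,1) MD]) (use M D V Va in auto)
  then have "char_poly M = char_poly D" by (rule char_poly_similar)
  also have "\<dots> = (\<Prod>x\<leftarrow>diag_mat D. [:- x, 1:])"
    by (rule char_poly_upper_triangular[OF D]) (auto simp: D_def upper_triangular_def)
  also have "diag_mat D = map (\<lambda>i. a (b i)) [0..<d]"
    by (auto simp: diag_mat_def D_def)
  also have "(\<Prod>x\<leftarrow>map (\<lambda>i. a (b i)) [0..<d]. [:- x, 1:]) = (\<Prod>i<d. [:- a (b i), 1:])"
    using prod.distinct_set_conv_list[of "[0..<d]" "\<lambda>i. [:- a (b i), 1:]"]
    by (simp add: atLeast0LessThan comp_def)
  also have "\<dots> = (\<Prod>i\<in>I. [:- a i, 1:])"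
    using prod.reindex_bij_betw[OF b, of "\<lambda>i. [:- a i, 1:]"] by simp
  finally show ?thesis .
qed

lemma vn_entropy_eigenbasis:
  fixes l :: "'i \<Rightarrow> real"
  assumes "M \<in> carrier_mat d d" "orthonormal_on d I e" "finite I" "card I = d"
    "\<And>i. i \<in> I \<Longrightarrow> M *\<^sub>v e i = complex_of_real (l i) \<cdot>\<^sub>v e i"
  shows "vn_entropy M = - (\<Sum>i\<in>I. l i * log 2 (l i))"
  by (rule vn_entropy_char_poly[OF assms(1,3) char_poly_eigenbasis[OF assms]])

section \<open>The spectral theorem for Hermitian matrices\<close>

lemma onb_ext:
  assumes e: "orthonormal_on d I e" "finite I" "card I = d"
    and v: "v \<in> carrier_vec d" and w: "w \<in> carrier_vec d"
    and eq: "\<And>i. i \<in> I \<Longrightarrow> v \<bullet>c e i = w \<bullet>c e i"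
  shows "v = w"
proof (rule eq_vecI)
  fix r assume "r < dim_vec w"
  then have r: "r < d" using w by simp
  show "v $ r = w $ r"
    using onb_expansion[OF e v r] onb_expansion[OF e w r] eq by simp
qed (use v w in auto)

text \<open>Induction on the number of eigenvectors. \<open>H\<close> is compressed to the
  orthogonal complement of those already found; an eigenvector of the compression is lifted back,
  and it is an eigenvector of \<open>H\<close> because self-adjointness makes the complement
  invariant.\<close>

lemma hermitian_eigenvectors:
  fixes H :: "complex mat"
  assumes H: "H \<in> carrier_mat d d" and herm: "mat_adjoint H = H" and "k \<le> d"
  shows "\<exists>e a. orthonormal_on d {..<k} e \<and> (\<forall>i<k. H *\<^sub>v e i = a i \<cdot>\<^sub>v e i)"
  using \<open>k \<le> d\<close>
proof (induction k)
  case 0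
  then show ?case by (simp add: orthonormal_on_def)
next
  case (Suc k)
  then obtain e0 a where e0: "orthonormal_on d {..<k} e0" "\<forall>i<k. H *\<^sub>v e0 i = a i \<cdot>\<^sub>v e0 i" by auto
  \<comment> \<open>The added vectors only coordinatize the orthogonal complement; they need not be
    eigenvectors.\<close>
  obtain e where e: "orthonormal_on d {..<d} e" and ee: "\<forall>i<k. e i = e0 i"
    using orthonormal_on_extend[of k d d e0] e0 Suc by auto
  have ek: "orthonormal_on d {..<k} e" using e Suc by (simp add: orthonormal_on_def)
  have eig: "H *\<^sub>v e i = a i \<cdot>\<^sub>v e i" if "i < k" for i using that e0 ee by simp
  have ec: "e i \<in> carrier_vec d" if "i < d" for i using e that by (simp add: orthonormal_on_def)
  have eip: "e i \<bullet>c e j = (if i = j then 1 else 0)" if "i < d" "j < d" for i j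
    using e that by (simp add: orthonormal_on_def)
  have He: "H *\<^sub>v e i \<in> carrier_vec d" if "i < d" for i
    using H ec[OF that] by (rule mult_mat_vec_carrier)
  have sa: "(H *\<^sub>v v) \<bullet>c w = v \<bullet>c (H *\<^sub>v w)" if "v \<in> carrier_vec d" "w \<in> carrier_vec d" for v w
    using cscalar_prod_adjoint[OF H that] herm by simp
  \<comment> \<open>The matrix of the compression in the basis \<open>e k, ..., e (d - 1)\<close> of
    the complement. Its size \<open>d - k\<close> is positive, so it has an eigenvalue.\<close>
  define G where "G = Matrix.mat (d - k) (d - k) (\<lambda>(i, j). (H *\<^sub>v e (k + j)) \<bullet>c e (k + i))"
  have G: "G \<in> carrier_mat (d - k) (d - k)" by (simp add: G_def)
  obtain \<mu> where "eigenvalue G \<mu>"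
    using spectrum_non_empty[OF G] Suc by (auto simp: spectrum_def)
  then obtain u where u: "u \<in> carrier_vec (d - k)" "u \<noteq> 0\<^sub>v (d - k)" "G *\<^sub>v u = \<mu> \<cdot>\<^sub>v u"
    using G by (auto simp: eigenvalue_def eigenvector_def)
  define v where "v = Matrix.vec d (\<lambda>r. \<Sum>j<d - k. u $ j * e (k + j) $ r)"
  have v: "v \<in> carrier_vec d" by (simp add: v_def)
  have Hv: "H *\<^sub>v v \<in> carrier_vec d" using H v by (rule mult_mat_vec_carrier)
  have vip: "v \<bullet>c w = (\<Sum>j<d - k. u $ j * (e (k + j) \<bullet>c w))" if w: "w \<in> carrier_vec d" for w
  proof -
    have "v \<bullet>c w = (\<Sum>r<d. \<Sum>j<d - k. u $ j * (e (k + j) $ r * cnj (w $ r)))"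
      by (simp add: cscalar_prod_sum[OF w] v_def sum_distrib_right mult.assoc)
    also have "\<dots> = (\<Sum>j<d - k. \<Sum>r<d. u $ j * (e (k + j) $ r * cnj (w $ r)))" by (rule sum.swap)
    finally show ?thesis by (simp add: cscalar_prod_sum[OF w] sum_distrib_left)
  qed
  have ve: "v \<bullet>c e i = (if i < k then 0 else u $ (i - k))" if i: "i < d" for i
  proof -
    have "v \<bullet>c e i = (\<Sum>j<d - k. if k + j = i then u $ j else 0)"
      unfolding vip[OF ec[OF i]] using i by (intro sum.cong) (auto simp: eip)
    also have "\<dots> = (\<Sum>j<d - k. if j = i - k then (if i < k then 0 else u $ j) else 0)"
      by (intro sum.cong) auto
    also have "\<dots> = (if i < k then 0 else u $ (i - k))" using i by auto
    finally show ?thesis .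
  qed
  \<comment> \<open>The eigenvalue equation is tested against each basis vector. For
    \<open>i < k\<close>, moving \<open>H\<close> onto the eigenvector \<open>e i\<close> makes both
    sides zero; for the others it is the equation for \<open>G\<close> and \<open>u\<close>.\<close>
  have Hve: "(H *\<^sub>v v) \<bullet>c e i = \<mu> * (v \<bullet>c e i)" if i: "i < d" for i
  proof (cases "i < k")
    case True
    have "(H *\<^sub>v v) \<bullet>c e i = v \<bullet>c (a i \<cdot>\<^sub>v e i)" using sa[OF v ec[OF i]] eig[OF True] by simp
    also have "\<dots> = cnj (a i) * (v \<bullet>c e i)"
      using ec[OF i] by (simp add: cscalar_prod_sum[of _ d] sum_distrib_left algebra_simps)
    finally show ?thesis using ve[OF i] True by simp
  next
    case False
    have "(H *\<^sub>v v) \<bullet>c e i = (\<Sum>j<d - k. u $ j * ((H *\<^sub>v e (k + j)) \<bullet>c e i))"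
      unfolding sa[OF v ec[OF i]] vip[OF He[OF i]]
      using i by (intro sum.cong) (simp_all add: sa ec)
    also have "\<dots> = (\<Sum>j<d - k. G $$ (i - k, j) * u $ j)"
      using i False by (intro sum.cong) (auto simp: G_def)
    also have "\<dots> = (G *\<^sub>v u) $ (i - k)"
      using i False by (intro mult_mat_vec_index[OF G u(1), symmetric]) simp
    also have "\<dots> = \<mu> * (v \<bullet>c e i)" unfolding u(3) using u(1) i False by (simp add: ve)
    finally show ?thesis .
  qed
  have eigv: "H *\<^sub>v v = \<mu> \<cdot>\<^sub>v v"
    by (rule onb_ext[OF e]) (use v Hv Hve ec in \<open>simp_all add: cscalar_prod_smult\<close>)
  have "v \<noteq> 0\<^sub>v d"
  proof
    assume "v = 0\<^sub>v d"
    then have "v \<bullet>c e (k + j) = 0" if "j < d - k" for j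
      using that by (simp add: cscalar_prod_sum[OF ec])
    then have "u = 0\<^sub>v (d - k)" using u(1) by (intro eq_vecI) (auto simp: ve)
    then show False using u by simp
  qed
  then obtain c where c: "(c \<cdot>\<^sub>v v) \<bullet>c (c \<cdot>\<^sub>v v) = 1" by (rule exists_normalized[OF v])
  have "orthonormal_on d {..<Suc k} (e(k := c \<cdot>\<^sub>v v))"
    by (rule orthonormal_on_insert[OF ek _ c]) (use v ve ec Suc in \<open>simp_all add: cscalar_prod_smult\<close>)
  moreover have "H *\<^sub>v (c \<cdot>\<^sub>v v) = \<mu> \<cdot>\<^sub>v (c \<cdot>\<^sub>v v)"
    using mult_mat_vec[OF H v, of c] eigv by (simp add: smult_smult_assoc mult.commute)
  then have "\<forall>i<Suc k. H *\<^sub>v (e(k := c \<cdot>\<^sub>v v)) i = (a(k := \<mu>)) i \<cdot>\<^sub>v (e(k := c \<cdot>\<^sub>v v)) i"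
    using eig by (auto simp: less_Suc_eq)
  ultimately show ?case by blast
qed

text \<open>Each eigenvalue is the expectation of \<open>H\<close> in a unit eigenvector, and
  self-adjointness makes this number its own conjugate.\<close>

lemma spectral_theorem:
  fixes H :: "complex mat"
  assumes H: "H \<in> carrier_mat d d" and herm: "mat_adjoint H = H"
  obtains e l where "orthonormal_on d {..<d} e"
    "\<And>i. i < d \<Longrightarrow> H *\<^sub>v e i = complex_of_real (l i) \<cdot>\<^sub>v e i"
proof -
  obtain e a where e: "orthonormal_on d {..<d} e" and ev: "\<And>i. i < d \<Longrightarrow> H *\<^sub>v e i = a i \<cdot>\<^sub>v e i"
    using hermitian_eigenvectors[OF assms order_refl] by blast
  have "a i = complex_of_real (Re (a i))" if i: "i < d" for i
  proof -
    have ei: "e i \<in> carrier_vec d" "e i \<bullet>c e i = 1" using e i by (simp_all add: orthonormal_on_def)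
    have 1: "(H *\<^sub>v e i) \<bullet>c e i = a i" using ei ev[OF i] by (simp add: cscalar_prod_smult)
    have "(H *\<^sub>v e i) \<bullet>c e i = e i \<bullet>c (H *\<^sub>v e i)" using cscalar_prod_adjoint[OF H ei(1) ei(1)] herm by simp
    also have "\<dots> = cnj ((H *\<^sub>v e i) \<bullet>c e i)"
      using H ei by (intro cscalar_prod_swap mult_mat_vec_carrier)
    finally show ?thesis using 1 by (metis Reals_cnj_iff complex_is_Real_iff of_real_Re)
  qed
  then show ?thesis using that[of e "\<lambda>i. Re (a i)"] e ev by simp
qed

section \<open>Tensor products\<close>

definition tensor_vec :: "complex vec \<Rightarrow> complex vec \<Rightarrow> complex vec" where
  "tensor_vec v w = Matrix.vec (dim_vec v * dim_vec w) (\<lambda>i. v $ (i div dim_vec w) * w $ (i mod dim_vec w))"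

lemma sum_div_mod:
  fixes f :: "nat \<Rightarrow> 'a::comm_monoid_add"
  shows "(\<Sum>i<a * b. f i) = (\<Sum>i<a. \<Sum>k<b. f (i * b + k))"
proof -
  have "(\<Sum>i<a * b. f i) = (\<Sum>i<a. sum f {i * b..<i * b + b})" by (rule sum.nat_group[symmetric])
  also have "\<dots> = (\<Sum>i<a. \<Sum>k<b. f (i * b + k))"
    by (rule sum.cong[OF refl], subst sum.atLeastLessThan_shift_0) (simp add: atLeast0LessThan)
  finally show ?thesis .
qed

lemma div_mod_less:
  assumes "i < a * (b::nat)"
  shows "i div b < a" "i mod b < b"
  using assms by (auto simp: less_mult_imp_div_less intro!: mod_less_divisor gr0I)

lemma mult_add_less:
  assumes "i < a" "k < (b::nat)"
  shows "i * b + k < a * b"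
proof -
  have "i * b + k < Suc i * b" using assms(2) by simp
  also have "\<dots> \<le> a * b" using assms(1) by (intro mult_le_mono1) simp
  finally show ?thesis .
qed

lemma tensor_vec_carrier [simp]:
  "v \<in> carrier_vec a \<Longrightarrow> w \<in> carrier_vec b \<Longrightarrow> tensor_vec v w \<in> carrier_vec (a * b)"
  by (auto simp: tensor_vec_def)

lemma tensor_vec_index:
  assumes "v \<in> carrier_vec a" "w \<in> carrier_vec b" "i < a" "k < b"
  shows "tensor_vec v w $ (i * b + k) = v $ i * w $ k"
  using assms mult_add_less[of i a k b] by (simp add: tensor_vec_def)

lemma tensor_mat_carrier [simp]:
  "M \<in> carrier_mat a c \<Longrightarrow> N \<in> carrier_mat b d \<Longrightarrow> tensor_mat M N \<in> carrier_mat (a * b) (c * d)"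
  by (auto simp: tensor_mat_def)

lemma tensor_mat_index:
  assumes "M \<in> carrier_mat a c" "N \<in> carrier_mat b d" "i < a" "k < b" "j < c" "l < d"
  shows "tensor_mat M N $$ (i * b + k, j * d + l) = M $$ (i, j) * N $$ (k, l)"
  using assms mult_add_less[of i a k b] mult_add_less[of j c l d] by (simp add: tensor_mat_def)

lemma eq_matI_tensor:
  assumes M: "M \<in> carrier_mat (a * b) (c * d)" and N: "N \<in> carrier_mat (a * b) (c * d)"
    and eq: "\<And>i k j l. i < a \<Longrightarrow> k < b \<Longrightarrow> j < c \<Longrightarrow> l < d
      \<Longrightarrow> M $$ (i * b + k, j * d + l) = N $$ (i * b + k, j * d + l)"
  shows "M = N"
proof (rule eq_matI)
  fix i j assume "i < dim_row N" "j < dim_col N"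
  then have ij: "i < a * b" "j < c * d" using N by auto
  show "M $$ (i, j) = N $$ (i, j)"
    using eq[OF div_mod_less[OF ij(1)] div_mod_less[OF ij(2)]] by simp
qed (use M N in auto)

lemma eq_vecI_tensor:
  assumes v: "v \<in> carrier_vec (a * b)" and w: "w \<in> carrier_vec (a * b)"
    and eq: "\<And>i k. i < a \<Longrightarrow> k < b \<Longrightarrow> v $ (i * b + k) = w $ (i * b + k)"
  shows "v = w"
proof (rule eq_vecI)
  fix i assume "i < dim_vec w"
  then have i: "i < a * b" using w by auto
  show "v $ i = w $ i"
    using eq[OF div_mod_less[OF i]] by simp
qed (use v w in auto)

lemma tensor_mat_mult:
  assumes M: "M \<in> carrier_mat a a'" and M': "M' \<in> carrier_mat a' a''"
    and N: "N \<in> carrier_mat b b'" and N': "N' \<in> carrier_mat b' b''"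
  shows "tensor_mat M N * tensor_mat M' N' = tensor_mat (M * M') (N * N')"
proof (rule eq_matI_tensor)
  fix i k j l assume ij: "i < a" "k < b" "j < a''" "l < b''"
  show "(tensor_mat M N * tensor_mat M' N') $$ (i * b + k, j * b'' + l)
      = tensor_mat (M * M') (N * N') $$ (i * b + k, j * b'' + l)"
    unfolding mult_mat_index[OF tensor_mat_carrier[OF M N] tensor_mat_carrier[OF M' N'] mult_add_less[OF ij(1,2)] mult_add_less[OF ij(3,4)]]
      tensor_mat_index[OF mult_carrier_mat[OF M M'] mult_carrier_mat[OF N N'] ij]
      mult_mat_index[OF M M' ij(1,3)] mult_mat_index[OF N N' ij(2,4)]
    using ij by (simp add: sum_div_mod sum_product tensor_mat_index[OF M N] tensor_mat_index[OF M' N'], simp add: algebra_simps)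
qed (rule mult_carrier_mat[OF tensor_mat_carrier[OF M N] tensor_mat_carrier[OF M' N']]
    tensor_mat_carrier[OF mult_carrier_mat[OF M M'] mult_carrier_mat[OF N N']])+

lemma tensor_mat_mult_vec:
  assumes M: "M \<in> carrier_mat a a'" and N: "N \<in> carrier_mat b b'"
    and v: "v \<in> carrier_vec a'" and w: "w \<in> carrier_vec b'"
  shows "tensor_mat M N *\<^sub>v tensor_vec v w = tensor_vec (M *\<^sub>v v) (N *\<^sub>v w)"
proof (rule eq_vecI_tensor)
  fix i k assume ij: "i < a" "k < b"
  show "(tensor_mat M N *\<^sub>v tensor_vec v w) $ (i * b + k) = tensor_vec (M *\<^sub>v v) (N *\<^sub>v w) $ (i * b + k)"
    unfolding mult_mat_vec_index[OF tensor_mat_carrier[OF M N] tensor_vec_carrier[OF v w] mult_add_less[OF ij]]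
      tensor_vec_index[OF mult_mat_vec_carrier[OF M v] mult_mat_vec_carrier[OF N w] ij]
      mult_mat_vec_index[OF M v ij(1)] mult_mat_vec_index[OF N w ij(2)]
    using ij by (simp add: sum_div_mod sum_product tensor_mat_index[OF M N] tensor_vec_index[OF v w], simp add: algebra_simps)
qed (use mult_mat_vec_carrier[OF tensor_mat_carrier[OF M N] tensor_vec_carrier[OF v w]]
    tensor_vec_carrier[OF mult_mat_vec_carrier[OF M v] mult_mat_vec_carrier[OF N w]] in auto)

lemma tensor_vec_cscalar_prod:
  assumes v: "v \<in> carrier_vec a" and w: "w \<in> carrier_vec b" and v': "v' \<in> carrier_vec a" and w': "w' \<in> carrier_vec b"
  shows "tensor_vec v w \<bullet>c tensor_vec v' w' = (v \<bullet>c v') * (w \<bullet>c w')"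
  unfolding cscalar_prod_sum[OF tensor_vec_carrier[OF v' w']] cscalar_prod_sum[OF v'] cscalar_prod_sum[OF w']
  by (simp add: sum_div_mod sum_product tensor_vec_index[OF v w] tensor_vec_index[OF v' w'], simp add: algebra_simps)

lemma tensor_mat_adjoint:
  assumes M: "M \<in> carrier_mat a a'" and N: "N \<in> carrier_mat b b'"
  shows "mat_adjoint (tensor_mat M N) = tensor_mat (mat_adjoint M) (mat_adjoint N)"
proof (rule eq_matI_tensor)
  fix i k j l assume ij: "i < a'" "k < b'" "j < a" "l < b"
  show "mat_adjoint (tensor_mat M N) $$ (i * b' + k, j * b + l)
      = tensor_mat (mat_adjoint M) (mat_adjoint N) $$ (i * b' + k, j * b + l)"
    using ij by (simp add: mat_adjoint_index[OF tensor_mat_carrier[OF M N]] mult_add_less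
        tensor_mat_index[OF M N] tensor_mat_index[OF mat_adjoint_carrier[OF M] mat_adjoint_carrier[OF N]]
        mat_adjoint_index[OF M] mat_adjoint_index[OF N])
qed (use assms in auto)

lemma nat_mult_add_eq_iff:
  assumes "k < b" "l < (b::nat)"
  shows "i * b + k = j * b + l \<longleftrightarrow> i = j \<and> k = l"
proof
  assume eq: "i * b + k = j * b + l"
  have "(i * b + k) div b = i" "(i * b + k) mod b = k" "(j * b + l) div b = j" "(j * b + l) mod b = l"
    using assms by auto
  then show "i = j \<and> k = l" using eq by metis
qed simp

lemma tensor_mat_one: "tensor_mat (1\<^sub>m a) (1\<^sub>m b) = 1\<^sub>m (a * b)"
  by (rule eq_matI_tensor[of _ a b a b])
    (auto simp: tensor_mat_index[OF one_carrier_mat one_carrier_mat] mult_add_less nat_mult_add_eq_iff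
        intro: tensor_mat_carrier)

section \<open>Rank-one operators, traces and matrix sums\<close>

lemma ketbra_carrier [simp]: "v \<in> carrier_vec d \<Longrightarrow> w \<in> carrier_vec d' \<Longrightarrow> ketbra v w \<in> carrier_mat d d'"
  by (auto simp: ketbra_def)

lemma ketbra_index:
  "v \<in> carrier_vec d \<Longrightarrow> w \<in> carrier_vec d' \<Longrightarrow> i < d \<Longrightarrow> j < d' \<Longrightarrow> ketbra v w $$ (i, j) = v $ i * cnj (w $ j)"
  by (auto simp: ketbra_def)

lemma ketbra_mult_vec:
  assumes v: "v \<in> carrier_vec d" and w: "w \<in> carrier_vec d'" and x: "x \<in> carrier_vec d'"
  shows "ketbra v w *\<^sub>v x = (x \<bullet>c w) \<cdot>\<^sub>v v"
proof (rule eq_vecI)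
  fix i assume "i < dim_vec ((x \<bullet>c w) \<cdot>\<^sub>v v)"
  then have i: "i < d" using v by simp
  show "(ketbra v w *\<^sub>v x) $ i = ((x \<bullet>c w) \<cdot>\<^sub>v v) $ i"
    using i v by (simp add: mult_mat_vec_index[OF ketbra_carrier[OF v w] x] ketbra_index[OF v w]
        cscalar_prod_sum[OF w] sum_distrib_left algebra_simps)
qed (use v in \<open>auto simp: ketbra_def\<close>)

lemma mult_ketbra:
  assumes M: "M \<in> carrier_mat a d" and v: "v \<in> carrier_vec d" and w: "w \<in> carrier_vec d'"
  shows "M * ketbra v w = ketbra (M *\<^sub>v v) w"
proof (rule eq_matI)
  have Mv: "M *\<^sub>v v \<in> carrier_vec a" using M v by (rule mult_mat_vec_carrier)
  fix i j assume "i < dim_row (ketbra (M *\<^sub>v v) w)" "j < dim_col (ketbra (M *\<^sub>v v) w)"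
  then have ij: "i < a" "j < d'" using ketbra_carrier[OF Mv w] by auto
  show "(M * ketbra v w) $$ (i, j) = ketbra (M *\<^sub>v v) w $$ (i, j)"
    using ij by (simp add: mult_mat_index[OF M ketbra_carrier[OF v w]] ketbra_index[OF v w]
        ketbra_index[OF Mv w] mult_mat_vec_index[OF M v] sum_distrib_left sum_distrib_right mult.assoc)
qed (use M v w in \<open>auto simp: ketbra_def\<close>)

lemma ketbra_mult_adjoint:
  assumes M: "M \<in> carrier_mat a d'" and v: "v \<in> carrier_vec d" and w: "w \<in> carrier_vec d'"
  shows "ketbra v w * mat_adjoint M = ketbra v (M *\<^sub>v w)"
proof (rule eq_matI)
  have Mw: "M *\<^sub>v w \<in> carrier_vec a" using M w by (rule mult_mat_vec_carrier)
  fix i j assume "i < dim_row (ketbra v (M *\<^sub>v w))" "j < dim_col (ketbra v (M *\<^sub>v w))"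
  then have ij: "i < d" "j < a" using ketbra_carrier[OF v Mw] by auto
  show "(ketbra v w * mat_adjoint M) $$ (i, j) = ketbra v (M *\<^sub>v w) $$ (i, j)"
    using ij by (simp add: mult_mat_index[OF ketbra_carrier[OF v w] mat_adjoint_carrier[OF M]]
        ketbra_index[OF v w] mat_adjoint_index[OF M]
        ketbra_index[OF v Mw] mult_mat_vec_index[OF M w] sum_distrib_left ac_simps)
qed (use M v w in \<open>auto simp: ketbra_def mat_adjoint_def\<close>)

lemma mat_adjoint_ketbra:
  assumes v: "v \<in> carrier_vec d" and w: "w \<in> carrier_vec d'"
  shows "mat_adjoint (ketbra v w) = ketbra w v"
proof (rule eq_matI)
  fix i j assume "i < dim_row (ketbra w v)" "j < dim_col (ketbra w v)"
  then have ij: "i < d'" "j < d" using ketbra_carrier[OF w v] by auto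
  then show "mat_adjoint (ketbra v w) $$ (i, j) = ketbra w v $$ (i, j)"
    by (simp add: mat_adjoint_index[OF ketbra_carrier[OF v w]] ketbra_index[OF v w] ketbra_index[OF w v])
qed (use v w in \<open>auto simp: ketbra_def mat_adjoint_def\<close>)

lemma mat_trace_ketbra:
  assumes v: "v \<in> carrier_vec d" and w: "w \<in> carrier_vec d"
  shows "mat_trace (ketbra v w) = v \<bullet>c w"
proof -
  have "dim_row (ketbra v w) = d" using ketbra_carrier[OF v w] by auto
  then show ?thesis
    by (simp add: mat_trace_def ketbra_index[OF v w] cscalar_prod_sum[OF w])
qed

lemma mat_trace_sum: "M \<in> carrier_mat d d' \<Longrightarrow> mat_trace M = (\<Sum>i<d. M $$ (i, i))"
  by (auto simp: mat_trace_def)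

lemma mat_trace_smult: "M \<in> carrier_mat d d \<Longrightarrow> mat_trace (c \<cdot>\<^sub>m M) = c * mat_trace M"
  by (auto simp: mat_trace_def sum_distrib_left)

lemma mat_trace_mat_sum:
  assumes "\<And>x. x \<in> I \<Longrightarrow> M x \<in> carrier_mat d d"
  shows "mat_trace (mat_sum d I M) = (\<Sum>x\<in>I. mat_trace (M x))"
proof -
  have "mat_trace (mat_sum d I M) = (\<Sum>i<d. \<Sum>x\<in>I. M x $$ (i, i))"
    by (simp add: mat_trace_sum[OF mat_sum_carrier] mat_sum_index)
  also have "\<dots> = (\<Sum>x\<in>I. \<Sum>i<d. M x $$ (i, i))" by (rule sum.swap)
  finally show ?thesis by (simp add: mat_trace_sum[OF assms])
qed

lemma mat_sum_cong:
  assumes "\<And>x. x \<in> I \<Longrightarrow> M x = N x"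
  shows "mat_sum d I M = mat_sum d I N"
  unfolding mat_sum_def using assms by (intro arg_cong[where f = "Matrix.mat d d"] ext sum.cong) auto

lemma mult_mat_sum:
  fixes B :: "complex mat"
  assumes B: "B \<in> carrier_mat d d" and M: "\<And>x. x \<in> I \<Longrightarrow> M x \<in> carrier_mat d d"
  shows "B * mat_sum d I M = mat_sum d I (\<lambda>x. B * M x)"
proof (rule eq_matI)
  fix i j assume "i < dim_row (mat_sum d I (\<lambda>x. B * M x))" "j < dim_col (mat_sum d I (\<lambda>x. B * M x))"
  then have ij: "i < d" "j < d" by (auto simp: mat_sum_def)
  have "(B * mat_sum d I M) $$ (i, j) = (\<Sum>k<d. \<Sum>x\<in>I. B $$ (i, k) * M x $$ (k, j))"
    using ij by (simp add: mult_mat_index[OF B mat_sum_carrier] mat_sum_index sum_distrib_left)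
  also have "\<dots> = (\<Sum>x\<in>I. \<Sum>k<d. B $$ (i, k) * M x $$ (k, j))" by (rule sum.swap)
  also have "\<dots> = mat_sum d I (\<lambda>x. B * M x) $$ (i, j)"
    using ij by (simp add: mat_sum_index mult_mat_index[OF B M])
  finally show "(B * mat_sum d I M) $$ (i, j) = mat_sum d I (\<lambda>x. B * M x) $$ (i, j)" .
qed (use B in \<open>auto simp: mat_sum_def\<close>)

lemma mat_sum_mult:
  fixes B :: "complex mat"
  assumes B: "B \<in> carrier_mat d d" and M: "\<And>x. x \<in> I \<Longrightarrow> M x \<in> carrier_mat d d"
  shows "mat_sum d I M * B = mat_sum d I (\<lambda>x. M x * B)"
proof (rule eq_matI)
  fix i j assume "i < dim_row (mat_sum d I (\<lambda>x. M x * B))" "j < dim_col (mat_sum d I (\<lambda>x. M x * B))"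
  then have ij: "i < d" "j < d" by (auto simp: mat_sum_def)
  have "(mat_sum d I M * B) $$ (i, j) = (\<Sum>k<d. \<Sum>x\<in>I. M x $$ (i, k) * B $$ (k, j))"
    using ij by (simp add: mult_mat_index[OF mat_sum_carrier B] mat_sum_index sum_distrib_right)
  also have "\<dots> = (\<Sum>x\<in>I. \<Sum>k<d. M x $$ (i, k) * B $$ (k, j))" by (rule sum.swap)
  also have "\<dots> = mat_sum d I (\<lambda>x. M x * B) $$ (i, j)"
    using ij by (simp add: mat_sum_index mult_mat_index[OF M B])
  finally show "(mat_sum d I M * B) $$ (i, j) = mat_sum d I (\<lambda>x. M x * B) $$ (i, j)" .
qed (use B in \<open>auto simp: mat_sum_def\<close>)

lemma mat_sum_mult_vec_cscalar_prod:
  assumes M: "\<And>x. x \<in> I \<Longrightarrow> M x \<in> carrier_mat d d" and v: "v \<in> carrier_vec d" and w: "w \<in> carrier_vec d"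
  shows "(mat_sum d I M *\<^sub>v v) \<bullet>c w = (\<Sum>x\<in>I. (M x *\<^sub>v v) \<bullet>c w)"
proof -
  have "(mat_sum d I M *\<^sub>v v) \<bullet>c w = (\<Sum>i<d. \<Sum>x\<in>I. (M x *\<^sub>v v) $ i * cnj (w $ i))"
    by (simp add: cscalar_prod_sum[OF w] mat_sum_mult_vec_index[OF M v] sum_distrib_right)
  also have "\<dots> = (\<Sum>x\<in>I. \<Sum>i<d. (M x *\<^sub>v v) $ i * cnj (w $ i))" by (rule sum.swap)
  finally show ?thesis by (simp add: cscalar_prod_sum[OF w])
qed

lemma smult_mat_mult_vec:
  fixes c :: complex
  assumes M: "M \<in> carrier_mat a b" and v: "v \<in> carrier_vec b"
  shows "(c \<cdot>\<^sub>m M) *\<^sub>v v = c \<cdot>\<^sub>v (M *\<^sub>v v)"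
proof (rule eq_vecI)
  fix i assume "i < dim_vec (c \<cdot>\<^sub>v (M *\<^sub>v v))"
  then have i: "i < a" using M by simp
  show "((c \<cdot>\<^sub>m M) *\<^sub>v v) $ i = (c \<cdot>\<^sub>v (M *\<^sub>v v)) $ i"
    using M v i
    by (simp add: mult_mat_vec_index[OF smult_carrier_mat[OF M] v] mult_mat_vec_index[OF M v] sum_distrib_left mult.assoc)
qed (use M in auto)

text \<open>Classical-quantum operators: block diagonal with respect to an orthonormal basis of the
  left factor.\<close>

definition cq_mat :: "nat \<Rightarrow> 'j set \<Rightarrow> ('j \<Rightarrow> complex vec) \<Rightarrow> ('j \<Rightarrow> complex) \<Rightarrow> ('j \<Rightarrow> complex mat) \<Rightarrow> complex mat" where
  "cq_mat b J ket c M = mat_sum (card J * b) J (\<lambda>j. c j \<cdot>\<^sub>m tensor_mat (ketbra (ket j) (ket j)) (M j))"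

context
  fixes J :: "'j set" and ket :: "'j \<Rightarrow> complex vec" and b :: nat
  assumes ket: "orthonormal_on (card J) J ket" and fin: "finite J"
begin

lemma ket_carrier: "j \<in> J \<Longrightarrow> ket j \<in> carrier_vec (card J)"
  using ket by (simp add: orthonormal_on_def)

lemma ket_cscalar_prod: "i \<in> J \<Longrightarrow> j \<in> J \<Longrightarrow> ket i \<bullet>c ket j = (if i = j then 1 else 0)"
  using ket by (simp add: orthonormal_on_def)

lemma sum_ketbra_diag:
  assumes "j \<in> J"
  shows "(\<Sum>i<card J. ketbra (ket j) (ket j) $$ (i, i)) = 1"
  using mat_trace_ketbra[OF ket_carrier ket_carrier, of j j] assms ket_cscalar_prod[of j j]
  by (simp add: mat_trace_sum[OF ketbra_carrier[OF ket_carrier ket_carrier]])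

lemma cq_mat_carrier: "cq_mat b J ket c M \<in> carrier_mat (card J * b) (card J * b)"
  by (simp add: cq_mat_def)

lemma cq_summand_carrier:
  "j \<in> J \<Longrightarrow> M j \<in> carrier_mat b b
    \<Longrightarrow> c j \<cdot>\<^sub>m tensor_mat (ketbra (ket j) (ket j)) (M j) \<in> carrier_mat (card J * b) (card J * b)"
  by (simp add: ket_carrier)

lemma cq_mat_index:
  assumes M: "\<And>j. j \<in> J \<Longrightarrow> M j \<in> carrier_mat b b" and i: "i < card J" "k < b" "i' < card J" "l < b"
  shows "cq_mat b J ket c M $$ (i * b + k, i' * b + l)
    = (\<Sum>j\<in>J. c j * (ketbra (ket j) (ket j) $$ (i, i') * M j $$ (k, l)))"
  unfolding cq_mat_def mat_sum_index[OF mult_add_less[OF i(1,2)] mult_add_less[OF i(3,4)]]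
proof (intro sum.cong refl)
  fix j assume j: "j \<in> J"
  have K: "ketbra (ket j) (ket j) \<in> carrier_mat (card J) (card J)" using ket_carrier[OF j] by simp
  show "(c j \<cdot>\<^sub>m tensor_mat (ketbra (ket j) (ket j)) (M j)) $$ (i * b + k, i' * b + l)
      = c j * (ketbra (ket j) (ket j) $$ (i, i') * M j $$ (k, l))"
    using tensor_mat_carrier[OF K M[OF j]] mult_add_less[OF i(1,2)] mult_add_less[OF i(3,4)]
    by (simp add: tensor_mat_index[OF K M[OF j] i])
qed

text \<open>Orthogonality of the kets removes every summand but the \<open>j\<close>-th. Hence
  eigenvectors of a block, tensored with its ket, are eigenvectors of the whole operator.\<close>

lemma cq_mat_mult_tensor_vec:
  assumes M: "\<And>j. j \<in> J \<Longrightarrow> M j \<in> carrier_mat b b" and j: "j \<in> J" and v: "v \<in> carrier_vec b"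
  shows "cq_mat b J ket c M *\<^sub>v tensor_vec (ket j) v = tensor_vec (ket j) (c j \<cdot>\<^sub>v (M j *\<^sub>v v))"
proof (rule eq_vecI)
  let ?t = "tensor_vec (ket j) v"
  have t: "?t \<in> carrier_vec (card J * b)" using ket_carrier[OF j] v by simp
  have Mv: "M j *\<^sub>v v \<in> carrier_vec b" using M[OF j] v by (rule mult_mat_vec_carrier)
  have T: "tensor_vec (ket j) (c j \<cdot>\<^sub>v (M j *\<^sub>v v)) \<in> carrier_vec (card J * b)"
    using ket_carrier[OF j] Mv by simp
  fix r assume "r < dim_vec (tensor_vec (ket j) (c j \<cdot>\<^sub>v (M j *\<^sub>v v)))"
  then have r: "r < card J * b" using T by simp
  have *: "((c i \<cdot>\<^sub>m tensor_mat (ketbra (ket i) (ket i)) (M i)) *\<^sub>v ?t) $ r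
      = (if i = j then tensor_vec (ket j) (c j \<cdot>\<^sub>v (M j *\<^sub>v v)) $ r else 0)" if i: "i \<in> J" for i
  proof -
    have K: "ketbra (ket i) (ket i) \<in> carrier_mat (card J) (card J)" using ket_carrier[OF i] by simp
    have "(c i \<cdot>\<^sub>m tensor_mat (ketbra (ket i) (ket i)) (M i)) *\<^sub>v ?t
        = c i \<cdot>\<^sub>v tensor_vec ((ket j \<bullet>c ket i) \<cdot>\<^sub>v ket i) (M i *\<^sub>v v)"
      unfolding smult_mat_mult_vec[OF tensor_mat_carrier[OF K M[OF i]] t]
        tensor_mat_mult_vec[OF K M[OF i] ket_carrier[OF j] v]
        ketbra_mult_vec[OF ket_carrier[OF i] ket_carrier[OF i] ket_carrier[OF j]] ..
    moreover have "r div b < card J" "r mod b < b" using div_mod_less[OF r] .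
    ultimately show ?thesis
      using r ket_cscalar_prod[OF j i] ket_carrier[OF i] ket_carrier[OF j] M[OF i, THEN carrier_matD(1)]
      by (auto simp: tensor_vec_def)
  qed
  have "(cq_mat b J ket c M *\<^sub>v ?t) $ r
      = (\<Sum>i\<in>J. ((c i \<cdot>\<^sub>m tensor_mat (ketbra (ket i) (ket i)) (M i)) *\<^sub>v ?t) $ r)"
    unfolding cq_mat_def using t r M by (intro mat_sum_mult_vec_index cq_summand_carrier) auto
  also have "\<dots> = tensor_vec (ket j) (c j \<cdot>\<^sub>v (M j *\<^sub>v v)) $ r"
    using fin j by (simp add: * cong: sum.cong)
  finally show "(cq_mat b J ket c M *\<^sub>v ?t) $ r = tensor_vec (ket j) (c j \<cdot>\<^sub>v (M j *\<^sub>v v)) $ r" .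
qed (use M[OF j] ket_carrier[OF j] in \<open>auto simp: cq_mat_def mat_sum_def tensor_vec_def\<close>)

text \<open>Tracing out the left factor replaces every \<open>ketbra (ket j) (ket j)\<close> by its
  trace \<open>1\<close>.\<close>

lemma ptrace_left_cq_mat:
  assumes M: "\<And>j. j \<in> J \<Longrightarrow> M j \<in> carrier_mat b b"
  shows "ptrace_left (card J) b (cq_mat b J ket c M) = mat_sum b J (\<lambda>j. c j \<cdot>\<^sub>m M j)"
proof (rule eq_matI)
  fix k l assume "k < dim_row (mat_sum b J (\<lambda>j. c j \<cdot>\<^sub>m M j))" "l < dim_col (mat_sum b J (\<lambda>j. c j \<cdot>\<^sub>m M j))"
  then have kl: "k < b" "l < b" by (auto simp: mat_sum_def)
  have "ptrace_left (card J) b (cq_mat b J ket c M) $$ (k, l)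
      = (\<Sum>i<card J. \<Sum>j\<in>J. c j * (ketbra (ket j) (ket j) $$ (i, i) * M j $$ (k, l)))"
    using kl by (simp add: ptrace_left_def cq_mat_index[OF M])
  also have "\<dots> = (\<Sum>j\<in>J. \<Sum>i<card J. ketbra (ket j) (ket j) $$ (i, i) * (c j * M j $$ (k, l)))"
    by (subst sum.swap) (simp add: ac_simps)
  also have "\<dots> = (\<Sum>j\<in>J. c j * M j $$ (k, l))"
    by (simp add: sum_distrib_right[symmetric] sum_ketbra_diag)
  also have "\<dots> = mat_sum b J (\<lambda>j. c j \<cdot>\<^sub>m M j) $$ (k, l)"
    unfolding mat_sum_index[OF kl] using M[THEN carrier_matD(1)] M[THEN carrier_matD(2)] kl
    by (intro sum.cong) auto
  finally show "ptrace_left (card J) b (cq_mat b J ket c M) $$ (k, l) = mat_sum b J (\<lambda>j. c j \<cdot>\<^sub>m M j) $$ (k, l)" .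
qed (auto simp: ptrace_left_def mat_sum_def)

lemma ptrace_right_cq_mat:
  assumes M: "\<And>j. j \<in> J \<Longrightarrow> M j \<in> carrier_mat b b"
  shows "ptrace_right (card J) b (cq_mat b J ket c M)
    = mat_sum (card J) J (\<lambda>j. (c j * mat_trace (M j)) \<cdot>\<^sub>m ketbra (ket j) (ket j))" (is "_ = ?R")
proof (rule eq_matI)
  fix i i' assume "i < dim_row ?R" "i' < dim_col ?R"
  then have ii: "i < card J" "i' < card J" by (auto simp: mat_sum_def)
  have "ptrace_right (card J) b (cq_mat b J ket c M) $$ (i, i')
      = (\<Sum>k<b. \<Sum>j\<in>J. c j * (ketbra (ket j) (ket j) $$ (i, i') * M j $$ (k, k)))"
    using ii by (simp add: ptrace_right_def cq_mat_index[OF M])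
  also have "\<dots> = (\<Sum>j\<in>J. \<Sum>k<b. c j * (ketbra (ket j) (ket j) $$ (i, i') * M j $$ (k, k)))"
    by (rule sum.swap)
  also have "\<dots> = (\<Sum>j\<in>J. c j * mat_trace (M j) * ketbra (ket j) (ket j) $$ (i, i'))"
    by (intro sum.cong refl) (simp add: mat_trace_sum[OF M] sum_distrib_left sum_distrib_right ac_simps)
  also have "\<dots> = ?R $$ (i, i')"
    unfolding mat_sum_index[OF ii] using ket_carrier[THEN carrier_vecD] ii
    by (intro sum.cong) (auto simp: ketbra_def)
  finally show "ptrace_right (card J) b (cq_mat b J ket c M) $$ (i, i') = ?R $$ (i, i')" .
qed (auto simp: ptrace_right_def mat_sum_def)

lemma mat_trace_cq_mat:
  assumes M: "\<And>j. j \<in> J \<Longrightarrow> M j \<in> carrier_mat b b"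
  shows "mat_trace (cq_mat b J ket c M) = (\<Sum>j\<in>J. c j * mat_trace (M j))"
proof -
  have "mat_trace (cq_mat b J ket c M)
      = (\<Sum>i<card J. \<Sum>k<b. \<Sum>j\<in>J. c j * (ketbra (ket j) (ket j) $$ (i, i) * M j $$ (k, k)))"
    by (simp add: mat_trace_sum[OF cq_mat_carrier] sum_div_mod cq_mat_index[OF M])
  also have "\<dots> = (\<Sum>j\<in>J. \<Sum>i<card J. \<Sum>k<b. c j * (ketbra (ket j) (ket j) $$ (i, i) * M j $$ (k, k)))"
    by (simp add: sum.swap[of _ J])
  also have "\<dots> = (\<Sum>j\<in>J. (\<Sum>i<card J. ketbra (ket j) (ket j) $$ (i, i)) * (c j * mat_trace (M j)))"
    by (intro sum.cong refl)
      (simp add: mat_trace_sum[OF M] sum_product sum_distrib_left ac_simps)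
  finally show ?thesis by (simp add: sum_ketbra_diag)
qed

text \<open>A measurement on the right factor acts inside the blocks, so the result keeps the block
  form and the same trace formulas apply before and after the measurement.\<close>

lemma tensor_one_mult_cq_mat:
  assumes M: "\<And>j. j \<in> J \<Longrightarrow> M j \<in> carrier_mat b b" and P: "P \<in> carrier_mat b b"
  shows "tensor_mat (1\<^sub>m (card J)) P * cq_mat b J ket c M = cq_mat b J ket c (\<lambda>j. P * M j)"
proof -
  have T: "tensor_mat (1\<^sub>m (card J)) P \<in> carrier_mat (card J * b) (card J * b)" using P by simp
  have "tensor_mat (1\<^sub>m (card J)) P * cq_mat b J ket c M
      = mat_sum (card J * b) J (\<lambda>j. tensor_mat (1\<^sub>m (card J)) P * (c j \<cdot>\<^sub>m tensor_mat (ketbra (ket j) (ket j)) (M j)))"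
    unfolding cq_mat_def by (intro mult_mat_sum T cq_summand_carrier M)
  also have "\<dots> = cq_mat b J ket c (\<lambda>j. P * M j)"
    unfolding cq_mat_def
  proof (rule mat_sum_cong)
    fix j assume j: "j \<in> J"
    have K: "ketbra (ket j) (ket j) \<in> carrier_mat (card J) (card J)" using ket_carrier[OF j] by simp
    show "tensor_mat (1\<^sub>m (card J)) P * (c j \<cdot>\<^sub>m tensor_mat (ketbra (ket j) (ket j)) (M j))
        = c j \<cdot>\<^sub>m tensor_mat (ketbra (ket j) (ket j)) (P * M j)"
      using mult_smult_distrib[OF T tensor_mat_carrier[OF K M[OF j]]]
        tensor_mat_mult[OF one_carrier_mat K P M[OF j]] K by simp
  qed
  finally show ?thesis .
qed

lemma cq_mat_mult_tensor_one:
  assumes M: "\<And>j. j \<in> J \<Longrightarrow> M j \<in> carrier_mat b b" and P: "P \<in> carrier_mat b b"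
  shows "cq_mat b J ket c M * tensor_mat (1\<^sub>m (card J)) P = cq_mat b J ket c (\<lambda>j. M j * P)"
proof -
  have T: "tensor_mat (1\<^sub>m (card J)) P \<in> carrier_mat (card J * b) (card J * b)" using P by simp
  have "cq_mat b J ket c M * tensor_mat (1\<^sub>m (card J)) P
      = mat_sum (card J * b) J (\<lambda>j. c j \<cdot>\<^sub>m tensor_mat (ketbra (ket j) (ket j)) (M j) * tensor_mat (1\<^sub>m (card J)) P)"
    unfolding cq_mat_def by (intro mat_sum_mult T cq_summand_carrier M)
  also have "\<dots> = cq_mat b J ket c (\<lambda>j. M j * P)"
    unfolding cq_mat_def
  proof (rule mat_sum_cong)
    fix j assume j: "j \<in> J"
    have K: "ketbra (ket j) (ket j) \<in> carrier_mat (card J) (card J)" using ket_carrier[OF j] by simp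
    show "c j \<cdot>\<^sub>m tensor_mat (ketbra (ket j) (ket j)) (M j) * tensor_mat (1\<^sub>m (card J)) P
        = c j \<cdot>\<^sub>m tensor_mat (ketbra (ket j) (ket j)) (M j * P)"
      using mult_smult_assoc_mat[OF tensor_mat_carrier[OF K M[OF j]] T]
        tensor_mat_mult[OF K one_carrier_mat M[OF j] P] K by simp
  qed
  finally show ?thesis .
qed

text \<open>The kets form the eigenbasis. The scalar \<open>q\<close> stays outside the sum because
  \<open>post_state\<close> normalizes after taking the partial trace.\<close>

lemma vn_entropy_scaled_sum_ketbra:
  fixes l :: "'j \<Rightarrow> real" and q :: real
  shows "vn_entropy (complex_of_real q \<cdot>\<^sub>m mat_sum (card J) J (\<lambda>j. complex_of_real (l j) \<cdot>\<^sub>m ketbra (ket j) (ket j)))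
    = - (\<Sum>j\<in>J. q * l j * log 2 (q * l j))" (is "vn_entropy (_ \<cdot>\<^sub>m ?R) = _")
proof (rule vn_entropy_eigenbasis[OF _ ket fin refl])
  have S: "complex_of_real (l i) \<cdot>\<^sub>m ketbra (ket i) (ket i) \<in> carrier_mat (card J) (card J)" if "i \<in> J" for i
    using ket_carrier[OF that] by simp
  fix j assume j: "j \<in> J"
  have kj: "ket j \<in> carrier_vec (card J)" by (rule ket_carrier[OF j])
  have "?R *\<^sub>v ket j = complex_of_real (l j) \<cdot>\<^sub>v ket j"
  proof (rule eq_vecI)
    fix r assume "r < dim_vec (complex_of_real (l j) \<cdot>\<^sub>v ket j)"
    then have r: "r < card J" using kj by simp
    have "(?R *\<^sub>v ket j) $ r = (\<Sum>i\<in>J. ((complex_of_real (l i) \<cdot>\<^sub>m ketbra (ket i) (ket i)) *\<^sub>v ket j) $ r)"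
      by (rule mat_sum_mult_vec_index[OF S kj r])
    also have "\<dots> = (\<Sum>i\<in>J. if i = j then complex_of_real (l j) * ket j $ r else 0)"
    proof (intro sum.cong refl)
      fix i assume i: "i \<in> J"
      show "((complex_of_real (l i) \<cdot>\<^sub>m ketbra (ket i) (ket i)) *\<^sub>v ket j) $ r
          = (if i = j then complex_of_real (l j) * ket j $ r else 0)"
        using r ket_carrier[OF i] kj ket_cscalar_prod[OF j i]
        by (simp add: smult_mat_mult_vec[OF ketbra_carrier[OF ket_carrier[OF i] ket_carrier[OF i]] kj]
            ketbra_mult_vec[OF ket_carrier[OF i] ket_carrier[OF i] kj])
    qed
    also have "\<dots> = (complex_of_real (l j) \<cdot>\<^sub>v ket j) $ r" using fin j r kj by simp
    finally show "(?R *\<^sub>v ket j) $ r = (complex_of_real (l j) \<cdot>\<^sub>v ket j) $ r" .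
  qed (use kj in \<open>auto simp: mat_sum_def\<close>)
  then show "(complex_of_real q \<cdot>\<^sub>m ?R) *\<^sub>v ket j = complex_of_real (q * l j) \<cdot>\<^sub>v ket j"
    by (simp add: smult_mat_mult_vec[OF mat_sum_carrier kj] smult_smult_assoc)
qed simp

end

section \<open>Projective measurements\<close>

definition projection :: "nat \<Rightarrow> complex mat \<Rightarrow> bool" where
  "projection d P \<longleftrightarrow> P \<in> carrier_mat d d \<and> mat_adjoint P = P \<and> P * P = P"

lemma projection_carrier: "projection d P \<Longrightarrow> P \<in> carrier_mat d d"
  by (simp add: projection_def)

text \<open>Self-adjointness and idempotence identify the expectation of \<open>P\<close> in
  \<open>v\<close> with the squared norm of the projected vector, so outcome probabilities are real
  and nonnegative.\<close>

lemma projection_cscalar_prod: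
  assumes P: "projection d P" and v: "v \<in> carrier_vec d"
  shows "(P *\<^sub>v v) \<bullet>c v = (P *\<^sub>v v) \<bullet>c (P *\<^sub>v v)"
    and "complex_of_real (Re ((P *\<^sub>v v) \<bullet>c v)) = (P *\<^sub>v v) \<bullet>c v"
    and "0 \<le> Re ((P *\<^sub>v v) \<bullet>c v)"
proof -
  have Pc: "P \<in> carrier_mat d d" and Pa: "mat_adjoint P = P" and PP: "P * P = P"
    using P by (auto simp: projection_def)
  have Pv: "P *\<^sub>v v \<in> carrier_vec d" using Pc v by (rule mult_mat_vec_carrier)
  have "P *\<^sub>v (P *\<^sub>v v) = P *\<^sub>v v"
    using assoc_mult_mat_vec[OF Pc Pc v] PP by simp
  then show 1: "(P *\<^sub>v v) \<bullet>c v = (P *\<^sub>v v) \<bullet>c (P *\<^sub>v v)"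
    using cscalar_prod_adjoint[OF Pc Pv v] Pa by simp
  show "complex_of_real (Re ((P *\<^sub>v v) \<bullet>c v)) = (P *\<^sub>v v) \<bullet>c v" "0 \<le> Re ((P *\<^sub>v v) \<bullet>c v)"
    unfolding 1 cscalar_prod_self[OF Pv] by (simp_all add: sum_nonneg)
qed

lemma projective_measurementD:
  assumes "projective_measurement d Ps" "k < length Ps"
  shows "projection d (Ps ! k)"
  using assms by (simp add: projective_measurement_def projection_def)

text \<open>An eigenbasis of \<open>\<Sum>\<^sub>k k \<Pi>\<^sub>k\<close> refines the decomposition of the space given by the \<open>\<Pi>\<^sub>k\<close>.\<close>

lemma measurement_eigenbasis:
  assumes Ps: "projective_measurement d Ps"
  obtains e g where "orthonormal_on d {..<d} e" "\<forall>y<d. g y < length Ps"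
    "\<forall>y<d. \<forall>k<length Ps. Ps ! k *\<^sub>v e y = (if k = g y then 1 else 0) \<cdot>\<^sub>v e y"
proof -
  let ?K = "length Ps"
  have Pc: "Ps ! k \<in> carrier_mat d d" and Pa: "mat_adjoint (Ps ! k) = Ps ! k" if "k < ?K" for k
    using Ps that by (auto simp: projective_measurement_def)
  have PP: "Ps ! k * Ps ! l = (if k = l then Ps ! k else 0\<^sub>m d d)" if "k < ?K" "l < ?K" for k l
    using Ps that by (auto simp: projective_measurement_def)
  \<comment> \<open>The labels \<open>k\<close> are distinct, so the nonzero ranges become different
    eigenspaces of \<open>H\<close>; a zero projection merely leaves its label out of the
    spectrum.\<close>
  define H where "H = mat_sum d {..<?K} (\<lambda>k. of_nat k \<cdot>\<^sub>m Ps ! k)"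
  have H: "H \<in> carrier_mat d d" by (simp add: H_def)
  have kPc: "of_nat k \<cdot>\<^sub>m Ps ! k \<in> carrier_mat d d" if "k \<in> {..<?K}" for k using Pc that by simp
  have Hidx: "H $$ (r, s) = (\<Sum>k<?K. of_nat k * Ps ! k $$ (r, s))" if "r < d" "s < d" for r s
    unfolding H_def mat_sum_index[OF that]
  proof (intro sum.cong refl)
    fix k assume "k \<in> {..<?K}"
    then have "dim_row (Ps ! k) = d" "dim_col (Ps ! k) = d" using Pc[of k] by auto
    then show "(of_nat k \<cdot>\<^sub>m Ps ! k) $$ (r, s) = of_nat k * Ps ! k $$ (r, s)" using that by simp
  qed
  have herm: "mat_adjoint H = H"
  proof (rule eq_matI)
    fix r s assume "r < dim_row H" "s < dim_col H"
    then have rs: "r < d" "s < d" using H by auto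
    have "cnj (Ps ! k $$ (s, r)) = Ps ! k $$ (r, s)" if "k < ?K" for k
      using mat_adjoint_index[OF Pc[OF that] rs] Pa[OF that] by simp
    then show "mat_adjoint H $$ (r, s) = H $$ (r, s)"
      unfolding mat_adjoint_index[OF H rs] using rs by (simp add: Hidx)
  qed (use H in \<open>auto simp: mat_adjoint_def\<close>)
  obtain e l where e: "orthonormal_on d {..<d} e"
    and ev: "\<And>i. i < d \<Longrightarrow> H *\<^sub>v e i = complex_of_real (l i) \<cdot>\<^sub>v e i"
    using spectral_theorem[OF H herm] by blast
  have ec: "e y \<in> carrier_vec d" and ee: "e y \<bullet>c e y = 1" if "y < d" for y
    using e that by (simp_all add: orthonormal_on_def)
  have PH: "Ps ! k * H = of_nat k \<cdot>\<^sub>m Ps ! k" if k: "k < ?K" for k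
  proof -
    have *: "Ps ! k * (of_nat l \<cdot>\<^sub>m Ps ! l) = (if l = k then of_nat k \<cdot>\<^sub>m Ps ! k else 0\<^sub>m d d)" if "l < ?K" for l
      using mult_smult_distrib[OF Pc[OF k] Pc[OF that], of "of_nat l"] PP[OF k that] by auto
    have PkH: "Ps ! k * H = mat_sum d {..<?K} (\<lambda>l. Ps ! k * (of_nat l \<cdot>\<^sub>m Ps ! l))"
      unfolding H_def by (rule mult_mat_sum[OF Pc[OF k]]) (rule kPc)
    show ?thesis
    proof (rule eq_matI)
      fix r s assume "r < dim_row (of_nat k \<cdot>\<^sub>m Ps ! k)" "s < dim_col (of_nat k \<cdot>\<^sub>m Ps ! k)"
      then have rs: "r < d" "s < d" using Pc[OF k] by auto
      have "(Ps ! k * H) $$ (r, s) = (\<Sum>l<?K. (Ps ! k * (of_nat l \<cdot>\<^sub>m Ps ! l)) $$ (r, s))"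
        using rs by (simp add: PkH mat_sum_index)
      also have "\<dots> = (\<Sum>l<?K. if l = k then (of_nat k \<cdot>\<^sub>m Ps ! k) $$ (r, s) else 0)"
        using rs by (intro sum.cong) (auto simp: *)
      finally show "(Ps ! k * H) $$ (r, s) = (of_nat k \<cdot>\<^sub>m Ps ! k) $$ (r, s)" using k by simp
    qed (use Pc[OF k] H in auto)
  qed
  have Pev: "complex_of_real (l y) \<cdot>\<^sub>v (Ps ! k *\<^sub>v e y) = of_nat k \<cdot>\<^sub>v (Ps ! k *\<^sub>v e y)" if k: "k < ?K" and y: "y < d" for k y
  proof -
    have "complex_of_real (l y) \<cdot>\<^sub>v (Ps ! k *\<^sub>v e y) = Ps ! k *\<^sub>v (H *\<^sub>v e y)"
      unfolding ev[OF y] by (rule mult_mat_vec[OF Pc[OF k] ec[OF y], symmetric])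
    also have "\<dots> = (Ps ! k * H) *\<^sub>v e y"
      by (rule assoc_mult_mat_vec[OF Pc[OF k] H ec[OF y], symmetric])
    also have "\<dots> = of_nat k \<cdot>\<^sub>v (Ps ! k *\<^sub>v e y)"
      unfolding PH[OF k] by (rule smult_mat_mult_vec[OF Pc[OF k] ec[OF y]])
    finally show ?thesis .
  qed
  \<comment> \<open>By \<open>Pev\<close>, the projected vector has the same multiple by
    \<open>l y\<close> and by \<open>k\<close>, so it vanishes unless the two scalars agree.\<close>
  have P0: "Ps ! k *\<^sub>v e y = 0\<^sub>v d" if k: "k < ?K" and y: "y < d" and ne: "l y \<noteq> real k" for k y
  proof (rule eq_vecI)
    fix r assume "r < dim_vec (0\<^sub>v d :: complex vec)"
    then have r: "r < d" by simp
    have "complex_of_real (l y) * (Ps ! k *\<^sub>v e y) $ r = complex_of_real (real k) * (Ps ! k *\<^sub>v e y) $ r"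
      using arg_cong[OF Pev[OF k y], of "\<lambda>v. v $ r"] r Pc[OF k] by simp
    then show "(Ps ! k *\<^sub>v e y) $ r = 0\<^sub>v d $ r"
      using ne r unfolding mult_cancel_right of_real_eq_iff by simp
  qed (use Pc[OF k] in simp)
  have sum1: "(\<Sum>k<?K. (Ps ! k *\<^sub>v e y) $ r) = e y $ r" if y: "y < d" and r: "r < d" for y r
  proof -
    have "(\<Sum>k<?K. (Ps ! k *\<^sub>v e y) $ r) = (mat_sum d {..<?K} ((!) Ps) *\<^sub>v e y) $ r"
      using Pc r ec[OF y] by (intro mat_sum_mult_vec_index[symmetric]) auto
    then show ?thesis using Ps ec[OF y] by (simp add: projective_measurement_def)
  qed
  \<comment> \<open>If no label matched, completeness of the measurement would force the unit vector
    \<open>e y\<close> to vanish.\<close>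
  have ex: "\<exists>k<?K. l y = real k" if y: "y < d" for y
  proof (rule ccontr)
    assume "\<not> ?thesis"
    then have "e y $ r = 0" if "r < d" for r
      using sum1[OF y that] P0[OF _ y] that by simp
    then have "e y \<bullet>c e y = 0" by (simp add: cscalar_prod_sum[OF ec[OF y]])
    then show False using ee[OF y] by simp
  qed
  \<comment> \<open>The eigenvalue is exactly a natural number, so the floor only converts its type;
    \<open>g\<close> need not reach the labels of zero projections.\<close>
  define g where "g = (\<lambda>y. nat \<lfloor>l y\<rfloor>)"
  have g: "g y < ?K" "l y = real (g y)" if "y < d" for y
    using ex[OF that] by (auto simp: g_def)
  have "Ps ! k *\<^sub>v e y = (if k = g y then 1 else 0) \<cdot>\<^sub>v e y" if k: "k < ?K" and y: "y < d" for k y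
  proof (cases "k = g y")
    case False
    then have "Ps ! k *\<^sub>v e y = 0\<^sub>v d" using g(2)[OF y] by (intro P0[OF k y]) simp
    then show ?thesis using False ec[OF y] by auto
  next
    case True
    have "Ps ! k *\<^sub>v e y = e y"
    proof (rule eq_vecI)
      fix r assume "r < dim_vec (e y)"
      then have r: "r < d" using ec[OF y] by simp
      have "e y $ r = (\<Sum>i<?K. if i = k then (Ps ! k *\<^sub>v e y) $ r else 0)"
        unfolding sum1[OF y r, symmetric] using P0[OF _ y] g(2)[OF y] True r
        by (intro sum.cong) auto
      then show "(Ps ! k *\<^sub>v e y) $ r = e y $ r" using k by simp
    qed (use Pc[OF k] ec[OF y] in simp)
    then show ?thesis using True by simp
  qed
  then show ?thesis using that[OF e] g(1) by blast
qed

section \<open>Compactness of the unitary group\<close>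

lemma unitary_norm:
  assumes W: "unitary_mat d W" and v: "v \<in> carrier_vec d"
  shows "(\<Sum>y<d. (cmod ((W *\<^sub>v v) $ y))\<^sup>2) = Re (v \<bullet>c v)"
proof -
  have Wc: "W \<in> carrier_mat d d" and WW: "mat_adjoint W * W = 1\<^sub>m d" using W by (auto simp: unitary_mat_def)
  have Wv: "W *\<^sub>v v \<in> carrier_vec d" using Wc v by (rule mult_mat_vec_carrier)
  have "(W *\<^sub>v v) \<bullet>c (W *\<^sub>v v) = v \<bullet>c v"
    using cscalar_prod_adjoint[OF Wc v Wv] assoc_mult_mat_vec[OF mat_adjoint_carrier[OF Wc] Wc v] WW v by simp
  then show ?thesis unfolding cscalar_prod_self[OF Wv] by (metis Re_complex_of_real)
qed

text \<open>Matrices are represented by coefficient functions in the product topology. Pinning the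
  entries outside the \<open>d\<close> by \<open>d\<close> block to \<open>0\<close> makes the set a
  product of compact sets, so Tychonoff's theorem applies.\<close>

lemma compact_matrix_box:
  "compact {X :: nat \<times> nat \<Rightarrow> complex. \<forall>i j. X (i, j) \<in> (if i < d \<and> j < d then cball 0 1 else {0})}"
proof -
  let ?B = "\<lambda>(i, j). if i < d \<and> j < d then cball 0 1 else {0 :: complex}"
  have "compactin (product_topology (\<lambda>_. euclidean) UNIV) (PiE UNIV ?B)"
    unfolding compactin_PiE by (auto simp: compactin_euclidean_iff)
  then have "compact (PiE UNIV ?B)"
    by (simp add: euclidean_product_topology compactin_euclidean_iff)
  also have "PiE UNIV ?B = {X. \<forall>i j. X (i, j) \<in> (if i < d \<and> j < d then cball 0 1 else {0})}"
    by (auto simp: PiE_def Pi_def split: if_splits)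
  finally show ?thesis .
qed

text \<open>The box supplies compactness, and orthonormality of the rows cuts out a closed subset of
  it.\<close>

definition unitary_coeffs :: "nat \<Rightarrow> (nat \<times> nat \<Rightarrow> complex) set" where
  "unitary_coeffs d = {X. (\<forall>i j. X (i, j) \<in> (if i < d \<and> j < d then cball 0 1 else {0}))
     \<and> (\<forall>y z. y < d \<longrightarrow> z < d \<longrightarrow> (\<Sum>i<d. X (y, i) * cnj (X (z, i))) = (if y = z then 1 else 0))}"

lemma compact_unitary_coeffs: "compact (unitary_coeffs d)"
proof -
  have "closed {X :: nat \<times> nat \<Rightarrow> complex. \<forall>y z. y < d \<longrightarrow> z < d
      \<longrightarrow> (\<Sum>i<d. X (y, i) * cnj (X (z, i))) = (if y = z then 1 else 0)}"
    by (intro closed_Collect_all closed_Collect_imp closed_Collect_eq open_Collect_const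
        continuous_on_sum continuous_on_mult continuous_on_cnj continuous_on_product_coordinates continuous_on_const)
  from compact_Int_closed[OF compact_matrix_box this] show ?thesis
    by (simp add: unitary_coeffs_def Collect_conj_eq)
qed

text \<open>For square matrices a one-sided inverse is two-sided, so unitarity reduces to one family
  of equations between continuous functions of the entries.\<close>

lemma unitary_mat_iff_rows:
  assumes W: "W \<in> carrier_mat d d"
  shows "unitary_mat d W \<longleftrightarrow>
    (\<forall>y z. y < d \<longrightarrow> z < d \<longrightarrow> (\<Sum>i<d. W $$ (y, i) * cnj (W $$ (z, i))) = (if y = z then 1 else 0))"
proof -
  have idx: "(W * mat_adjoint W) $$ (y, z) = (\<Sum>i<d. W $$ (y, i) * cnj (W $$ (z, i)))" if "y < d" "z < d" for y z
    using that by (simp add: mult_mat_index[OF W mat_adjoint_carrier[OF W]] mat_adjoint_index[OF W])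
  have "unitary_mat d W \<longleftrightarrow> W * mat_adjoint W = 1\<^sub>m d"
    using mat_mult_left_right_inverse[OF W mat_adjoint_carrier[OF W]] W by (auto simp: unitary_mat_def)
  also have "\<dots> \<longleftrightarrow> (\<forall>y z. y < d \<longrightarrow> z < d \<longrightarrow> (W * mat_adjoint W) $$ (y, z) = 1\<^sub>m d $$ (y, z))"
  proof (intro iffI)
    assume "\<forall>y z. y < d \<longrightarrow> z < d \<longrightarrow> (W * mat_adjoint W) $$ (y, z) = 1\<^sub>m d $$ (y, z)"
    then show "W * mat_adjoint W = 1\<^sub>m d"
      using W by (intro eq_matI) (auto simp: mat_adjoint_def)
  qed simp
  finally show ?thesis by (auto simp: idx)
qed

lemma unitary_mat_coeffs:
  assumes "X \<in> unitary_coeffs d"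
  shows "unitary_mat d (Matrix.mat d d X)"
  using assms by (subst unitary_mat_iff_rows) (auto simp: unitary_coeffs_def)

text \<open>A row of norm \<open>1\<close> has entries of modulus at most \<open>1\<close>, so the
  box contains every unitary.\<close>

lemma coeffs_unitary_mat:
  assumes W: "unitary_mat d W"
  shows "(\<lambda>(i, j). if i < d \<and> j < d then W $$ (i, j) else 0) \<in> unitary_coeffs d"
proof -
  have Wc: "W \<in> carrier_mat d d" using W by (simp add: unitary_mat_def)
  have rows: "(\<Sum>i<d. W $$ (y, i) * cnj (W $$ (z, i))) = (if y = z then 1 else 0)" if "y < d" "z < d" for y z
    using W that unfolding unitary_mat_iff_rows[OF Wc] by blast
  have "cmod (W $$ (i, j)) \<le> 1" if ij: "i < d" "j < d" for i j
  proof -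
    have "complex_of_real (\<Sum>k<d. (cmod (W $$ (i, k)))\<^sup>2) = 1"
      using rows[OF ij(1) ij(1)] by (simp only: of_real_sum complex_norm_square) simp
    then have "(\<Sum>k<d. (cmod (W $$ (i, k)))\<^sup>2) = 1" by (simp only: of_real_eq_1_iff)
    moreover have "(cmod (W $$ (i, j)))\<^sup>2 \<le> (\<Sum>k<d. (cmod (W $$ (i, k)))\<^sup>2)"
      using ij by (intro member_le_sum) auto
    ultimately have "(cmod (W $$ (i, j)))\<^sup>2 \<le> 1\<^sup>2" by simp
    then show ?thesis by (rule power2_le_imp_le) simp
  qed
  then show ?thesis using rows by (auto simp: unitary_coeffs_def)
qed

section \<open>Measuring the oracle state\<close>

text \<open>The bound \<open>x \<le> q\<close> takes care of \<open>q = 0\<close>, where it forces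
  \<open>x = 0\<close>.\<close>

lemma xlog_div:
  fixes x q :: real
  assumes "0 \<le> x" "x \<le> q"
  shows "x * log 2 (x / q) = x * log 2 x - x * log 2 q"
proof (cases "x = 0")
  case False
  then show ?thesis using assms by (simp add: log_divide right_diff_distrib)
qed simp

lemma xlog_mult:
  fixes x q :: real
  assumes "0 \<le> x" "0 < q"
  shows "q * x * log 2 (q * x) = x * (q * log 2 q) + q * (x * log 2 x)"
proof (cases "x = 0")
  case False
  then show ?thesis using assms by (simp add: log_mult algebra_simps)
qed simp

locale oracle_measurement = oracle_classification F J A m U p
  for F :: "'f set" and J :: "'j set" and A :: "'j \<Rightarrow> 'f set"
    and m :: nat and U :: "'f \<Rightarrow> complex mat" and p :: "'f \<Rightarrow> real" +
  fixes n :: nat and \<psi> :: "complex vec" and ket :: "'j \<Rightarrow> complex vec"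
  assumes n_ge: "n \<ge> m" and pure: "pure_state n \<psi>" and ket: "orthonormal_on (card J) J ket"
begin

abbreviation d :: nat where "d \<equiv> 2 ^ n"
abbreviation \<sigma> :: "'j \<Rightarrow> complex mat" where "\<sigma> \<equiv> class_state A n m U p \<psi>"
abbreviation \<rho> :: "complex mat" where "\<rho> \<equiv> joint_state J A n m U p \<psi> ket"

definition \<phi> :: "'f \<Rightarrow> complex vec" where "\<phi> f = query n m U f *\<^sub>v \<psi>"

text \<open>For a projection \<open>P\<close> this is the joint probability that
  \<open>J = j\<close> and the outcome is \<open>P\<close>, the \<open>r(j,k)\<close> of the
  overview for \<open>P = P_k\<close>. It contains the factor p_j and is not conditioned on the
  class.\<close>

definition weight :: "complex mat \<Rightarrow> 'j \<Rightarrow> real" where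
  "weight P j = (\<Sum>f\<in>A j. p f * Re ((P *\<^sub>v \<phi> f) \<bullet>c \<phi> f))"

lemma A_subset: "j \<in> J \<Longrightarrow> A j \<subseteq> F"
  using Union_classes by auto

lemma finite_A: "j \<in> J \<Longrightarrow> finite (A j)"
  using A_subset finite_F finite_subset by blast

text \<open>Choosing a representative of each class injects \<open>J\<close> into \<open>F\<close>,
  since the classes are nonempty and disjoint.\<close>

lemma finite_J: "finite J"
proof -
  have "inj_on (\<lambda>j. SOME f. f \<in> A j) J"
  proof (rule inj_onI)
    fix i j assume ij: "i \<in> J" "j \<in> J" and eq: "(SOME f. f \<in> A i) = (SOME f. f \<in> A j)"
    have "(SOME f. f \<in> A i) \<in> A i" "(SOME f. f \<in> A j) \<in> A j"
      using class_nonempty ij by (auto intro: some_in_eq[THEN iffD2])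
    then have "A i \<inter> A j \<noteq> {}" using eq by auto
    then show "i = j" using disjoint_classes ij by (auto simp: disjoint_family_on_def)
  qed
  moreover have "(\<lambda>j. SOME f. f \<in> A j) ` J \<subseteq> F"
    using class_nonempty A_subset by (auto intro!: subsetD[OF A_subset] some_in_eq[THEN iffD2])
  ultimately show ?thesis using finite_F by (metis finite_imageD finite_subset)
qed

lemma class_index_eq:
  assumes "j \<in> J" "f \<in> A j"
  shows "class_index J A f = j"
  unfolding class_index_def
  using assms disjoint_classes by (intro the_equality) (auto simp: disjoint_family_on_def)

lemma class_prob_positive: "j \<in> J \<Longrightarrow> class_prob A p j > 0"
  using class_prob_pos by (simp add: class_prob_def)

lemma p_nonneg_A: "j \<in> J \<Longrightarrow> f \<in> A j \<Longrightarrow> 0 \<le> p f"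
  using p_nonneg A_subset by blast

lemma query_carrier: "f \<in> F \<Longrightarrow> query n m U f \<in> carrier_mat d d"
  using unitary_U[of f] tensor_mat_carrier[of "U f" "2 ^ m" "2 ^ m" "1\<^sub>m (2 ^ (n - m))" "2 ^ (n - m)" "2 ^ (n - m)"] n_ge
  by (simp add: query_def unitary_mat_def power_add[symmetric])

lemma psi_carrier: "\<psi> \<in> carrier_vec d"
  using pure by (simp add: pure_state_def)

lemma \<phi>_carrier: "f \<in> F \<Longrightarrow> \<phi> f \<in> carrier_vec d"
  unfolding \<phi>_def by (rule mult_mat_vec_carrier[OF query_carrier psi_carrier])

lemma \<phi>_carrier_A: "j \<in> J \<Longrightarrow> f \<in> A j \<Longrightarrow> \<phi> f \<in> carrier_vec d"
  using \<phi>_carrier A_subset by blast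

text \<open>A unitary tensored with an identity is an isometry; \<open>n \<ge> m\<close> makes the
  dimensions multiply to \<open>2 ^ n\<close>.\<close>

lemma \<phi>_normalized:
  assumes f: "f \<in> F"
  shows "\<phi> f \<bullet>c \<phi> f = 1"
proof -
  have U: "U f \<in> carrier_mat (2 ^ m) (2 ^ m)" "mat_adjoint (U f) * U f = 1\<^sub>m (2 ^ m)"
    using unitary_U[OF f] by (auto simp: unitary_mat_def)
  let ?I = "1\<^sub>m (2 ^ (n - m)) :: complex mat"
  have I: "mat_adjoint ?I = ?I"
    by (rule eq_matI) (auto simp: mat_adjoint_index[OF one_carrier_mat], auto simp: mat_adjoint_def)
  have "mat_adjoint (query n m U f) * query n m U f = 1\<^sub>m d"
    unfolding query_def tensor_mat_adjoint[OF U(1) one_carrier_mat] I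
      tensor_mat_mult[OF mat_adjoint_carrier[OF U(1)] U(1) one_carrier_mat one_carrier_mat] U(2)
    using n_ge by (simp add: tensor_mat_one power_add[symmetric])
  moreover have "\<phi> f \<bullet>c \<phi> f = \<psi> \<bullet>c ((mat_adjoint (query n m U f) * query n m U f) *\<^sub>v \<psi>)"
    using cscalar_prod_adjoint[OF query_carrier[OF f] psi_carrier \<phi>_carrier[OF f]]
      assoc_mult_mat_vec[OF mat_adjoint_carrier[OF query_carrier[OF f]] query_carrier[OF f] psi_carrier]
    by (simp add: \<phi>_def)
  ultimately show ?thesis using pure psi_carrier by (simp add: pure_state_def)
qed

lemma class_state_eq:
  assumes j: "j \<in> J"
  shows "\<sigma> j = mat_sum d (A j) (\<lambda>f. complex_of_real (p f / class_prob A p j) \<cdot>\<^sub>m ketbra (\<phi> f) (\<phi> f))"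
  unfolding class_state_def
proof (rule mat_sum_cong)
  fix f assume "f \<in> A j"
  then have f: "f \<in> F" using A_subset[OF j] by auto
  have Q: "query n m U f \<in> carrier_mat d d" by (rule query_carrier[OF f])
  have "query n m U f * ketbra \<psi> \<psi> * mat_adjoint (query n m U f) = ketbra (\<phi> f) (\<phi> f)"
    unfolding \<phi>_def mult_ketbra[OF Q psi_carrier psi_carrier]
    by (rule ketbra_mult_adjoint[OF Q mult_mat_vec_carrier[OF Q psi_carrier] psi_carrier])
  then show "complex_of_real (p f / class_prob A p j) \<cdot>\<^sub>m (query n m U f * ketbra \<psi> \<psi> * mat_adjoint (query n m U f))
      = complex_of_real (p f / class_prob A p j) \<cdot>\<^sub>m ketbra (\<phi> f) (\<phi> f)" by simp
qed

lemma \<sigma>_carrier: "\<sigma> j \<in> carrier_mat d d"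
  by (simp add: class_state_def)

lemma \<sigma>_summand_carrier:
  assumes "j \<in> J" "f \<in> A j"
  shows "c \<cdot>\<^sub>m ketbra (\<phi> f) (\<phi> f) \<in> carrier_mat d d"
  using \<phi>_carrier_A[OF assms] by simp

lemma \<sigma>_hermitian:
  assumes j: "j \<in> J"
  shows "mat_adjoint (\<sigma> j) = \<sigma> j"
proof (rule eq_matI)
  fix r s assume "r < dim_row (\<sigma> j)" "s < dim_col (\<sigma> j)"
  then have rs: "r < d" "s < d" using \<sigma>_carrier[of j] by auto
  have idx: "(c \<cdot>\<^sub>m ketbra (\<phi> f) (\<phi> f)) $$ (r', s') = c * (\<phi> f $ r' * cnj (\<phi> f $ s'))"
    if "f \<in> A j" "r' < d" "s' < d" for f c r' s'
    using that \<phi>_carrier_A[OF j that(1), THEN carrier_vecD] by (simp add: ketbra_def)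
  show "mat_adjoint (\<sigma> j) $$ (r, s) = \<sigma> j $$ (r, s)"
    unfolding mat_adjoint_index[OF \<sigma>_carrier rs] unfolding class_state_eq[OF j]
    using rs by (simp add: mat_sum_index idx ac_simps)
qed (use \<sigma>_carrier[of j] in \<open>auto simp: mat_adjoint_def\<close>)

text \<open>Positivity of \<open>\<sigma> j\<close> in the form needed for its eigenvalues: the
  expectation in \<open>v\<close> is a nonnegative combination of squared overlaps.\<close>

lemma \<sigma>_cscalar_prod:
  assumes j: "j \<in> J" and v: "v \<in> carrier_vec d"
  shows "(\<sigma> j *\<^sub>v v) \<bullet>c v
    = complex_of_real (\<Sum>f\<in>A j. p f / class_prob A p j * (cmod (\<phi> f \<bullet>c v))\<^sup>2)"
proof -
  have "(\<sigma> j *\<^sub>v v) \<bullet>c v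
      = (\<Sum>f\<in>A j. ((complex_of_real (p f / class_prob A p j) \<cdot>\<^sub>m ketbra (\<phi> f) (\<phi> f)) *\<^sub>v v) \<bullet>c v)"
    unfolding class_state_eq[OF j]
    by (rule mat_sum_mult_vec_cscalar_prod[OF \<sigma>_summand_carrier[OF j] v v])
  also have "\<dots> = (\<Sum>f\<in>A j. complex_of_real (p f / class_prob A p j) * complex_of_real ((cmod (\<phi> f \<bullet>c v))\<^sup>2))"
  proof (intro sum.cong refl)
    fix f assume "f \<in> A j"
    then have c: "\<phi> f \<in> carrier_vec d" by (rule \<phi>_carrier_A[OF j])
    have "((complex_of_real (p f / class_prob A p j) \<cdot>\<^sub>m ketbra (\<phi> f) (\<phi> f)) *\<^sub>v v) \<bullet>c v
        = complex_of_real (p f / class_prob A p j) * ((v \<bullet>c \<phi> f) * (\<phi> f \<bullet>c v))"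
      unfolding smult_mat_mult_vec[OF ketbra_carrier[OF c c] v] ketbra_mult_vec[OF c c v]
      using c v by (simp add: cscalar_prod_smult)
    also have "(v \<bullet>c \<phi> f) * (\<phi> f \<bullet>c v) = complex_of_real ((cmod (\<phi> f \<bullet>c v))\<^sup>2)"
      unfolding cscalar_prod_swap[OF c v] complex_norm_square by (simp add: mult.commute)
    finally show "((complex_of_real (p f / class_prob A p j) \<cdot>\<^sub>m ketbra (\<phi> f) (\<phi> f)) *\<^sub>v v) \<bullet>c v
        = complex_of_real (p f / class_prob A p j) * complex_of_real ((cmod (\<phi> f \<bullet>c v))\<^sup>2)" .
  qed
  finally show ?thesis by simp
qed

text \<open>An eigenvalue is the expectation of \<open>\<sigma> j\<close> in its eigenvector, hence
  nonnegative. By Parseval the overlaps of each unit vector \<open>\<phi> f\<close> with the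
  eigenbasis sum to \<open>1\<close>, so the eigenvalues form a probability distribution.\<close>

lemma \<sigma>_spectrum:
  assumes j: "j \<in> J"
  obtains e l where "orthonormal_on d {..<d} e"
    "\<forall>k<d. \<sigma> j *\<^sub>v e k = complex_of_real (l k) \<cdot>\<^sub>v e k" "\<forall>k<d. 0 \<le> l k" "(\<Sum>k<d. l k) = 1"
proof -
  obtain e l where e: "orthonormal_on d {..<d} e"
    and ev: "\<And>k. k < d \<Longrightarrow> \<sigma> j *\<^sub>v e k = complex_of_real (l k) \<cdot>\<^sub>v e k"
    using spectral_theorem[OF \<sigma>_carrier \<sigma>_hermitian[OF j]] by blast
  have l: "l k = (\<Sum>f\<in>A j. p f / class_prob A p j * (cmod (\<phi> f \<bullet>c e k))\<^sup>2)" if k: "k < d" for k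
  proof -
    have ek: "e k \<in> carrier_vec d" "e k \<bullet>c e k = 1" using e k by (simp_all add: orthonormal_on_def)
    have "complex_of_real (l k) = (\<sigma> j *\<^sub>v e k) \<bullet>c e k"
      using ek by (simp add: ev[OF k] cscalar_prod_smult)
    then show ?thesis unfolding \<sigma>_cscalar_prod[OF j ek(1)] of_real_eq_iff .
  qed
  have "(\<Sum>k<d. l k) = (\<Sum>f\<in>A j. p f / class_prob A p j * (\<Sum>k<d. (cmod (\<phi> f \<bullet>c e k))\<^sup>2))"
    by (simp add: l sum_distrib_left) (rule sum.swap)
  also have "\<dots> = (\<Sum>f\<in>A j. p f / class_prob A p j)"
  proof (intro sum.cong refl)
    fix f assume "f \<in> A j"
    then have "f \<in> F" using A_subset[OF j] by auto
    then show "p f / class_prob A p j * (\<Sum>k<d. (cmod (\<phi> f \<bullet>c e k))\<^sup>2) = p f / class_prob A p j"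
      using parseval_norm[OF e \<phi>_carrier] \<phi>_normalized by simp
  qed
  also have "\<dots> = 1"
    using class_prob_positive[OF j] by (simp add: class_prob_def sum_divide_distrib[symmetric])
  finally have "(\<Sum>k<d. l k) = 1" .
  moreover have "0 \<le> l k" if "k < d" for k
    unfolding l[OF that] using p_nonneg_A[OF j] class_prob_positive[OF j]
    by (intro sum_nonneg mult_nonneg_nonneg divide_nonneg_pos) auto
  ultimately show ?thesis using that e ev by blast
qed

section \<open>Entropies of the joint and post-measurement states, and the discord of a
  measurement\<close>

lemma \<rho>_cq: "\<rho> = cq_mat d J ket (\<lambda>j. complex_of_real (class_prob A p j)) \<sigma>"
  by (simp add: joint_state_def cq_mat_def)

text \<open>Tensoring each ket with an eigenbasis of the corresponding \<open>\<sigma> j\<close>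
  gives an eigenbasis of \<open>\<rho>\<close> with eigenvalues
  \<open>class_prob A p j * l j k\<close>. The chain rule for the entropy of this product form
  yields the claim.\<close>

lemma vn_entropy_\<rho>:
  "vn_entropy \<rho> = - (\<Sum>j\<in>J. class_prob A p j * log 2 (class_prob A p j))
    + (\<Sum>j\<in>J. class_prob A p j * vn_entropy (\<sigma> j))"
proof -
  let ?P = "\<lambda>j e l. orthonormal_on d {..<d} e \<and> (\<forall>k<d. \<sigma> j *\<^sub>v e k = complex_of_real (l k) \<cdot>\<^sub>v e k)
    \<and> (\<forall>k<d. 0 \<le> l k) \<and> (\<Sum>k<d. l k) = 1"
  have "\<forall>j\<in>J. \<exists>e l. ?P j e l" by (metis \<sigma>_spectrum)
  then obtain e where "\<forall>j\<in>J. \<exists>l. ?P j (e j) l" by metis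
  then obtain l where el: "\<forall>j\<in>J. ?P j (e j) (l j)" by metis
  have e: "orthonormal_on d {..<d} (e j)" and l0: "k < d \<Longrightarrow> 0 \<le> l j k" and l1: "(\<Sum>k<d. l j k) = 1"
    and ev: "k < d \<Longrightarrow> \<sigma> j *\<^sub>v e j k = complex_of_real (l j k) \<cdot>\<^sub>v e j k" if "j \<in> J" for j k
    using el that by auto
  have ec: "e j k \<in> carrier_vec d" if "j \<in> J" "k < d" for j k using e that by (simp add: orthonormal_on_def)
  have eip: "e j k \<bullet>c e j k' = (if k = k' then 1 else 0)" if "j \<in> J" "k < d" "k' < d" for j k k'
    using e that by (simp add: orthonormal_on_def)
  define E where "E = (\<lambda>(j, k). tensor_vec (ket j) (e j k))"
  have Ec: "E x \<in> carrier_vec (card J * d)" if "x \<in> J \<times> {..<d}" for x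
    using that ket_carrier[OF ket finite_J] ec by (auto simp: E_def)
  have "E x \<bullet>c E y = (if x = y then 1 else 0)" if x: "x \<in> J \<times> {..<d}" and y: "y \<in> J \<times> {..<d}" for x y
  proof -
    obtain j k i l where xy: "x = (j, k)" "y = (i, l)" and jk: "j \<in> J" "k < d" "i \<in> J" "l < d"
      using x y by auto
    show ?thesis
      unfolding xy E_def prod.case
        tensor_vec_cscalar_prod[OF ket_carrier[OF ket finite_J jk(1)] ec[OF jk(1,2)]
          ket_carrier[OF ket finite_J jk(3)] ec[OF jk(3,4)]] ket_cscalar_prod[OF ket finite_J jk(1,3)]
      using jk by (auto simp: eip)
  qed
  then have onb: "orthonormal_on (card J * d) (J \<times> {..<d}) E"
    using Ec by (simp add: orthonormal_on_def)
  have "vn_entropy \<rho> = - (\<Sum>(j, k)\<in>J \<times> {..<d}. class_prob A p j * l j k * log 2 (class_prob A p j * l j k))"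
    unfolding case_prod_unfold
  proof (rule vn_entropy_eigenbasis[OF _ onb])
    show "\<rho> \<in> carrier_mat (card J * d) (card J * d)" by (simp add: joint_state_def)
    fix x assume "x \<in> J \<times> {..<d}"
    then obtain j k where x: "x = (j, k)" and jk: "j \<in> J" "k < d" by auto
    have "\<rho> *\<^sub>v E x = tensor_vec (ket j) (complex_of_real (class_prob A p j) \<cdot>\<^sub>v (complex_of_real (l j k) \<cdot>\<^sub>v e j k))"
      unfolding \<rho>_cq x E_def prod.case ev[OF jk, symmetric]
      by (rule cq_mat_mult_tensor_vec[OF ket finite_J \<sigma>_carrier jk(1) ec[OF jk]])
    also have "\<dots> = complex_of_real (class_prob A p j * l j k) \<cdot>\<^sub>v E x"
    proof (rule eq_vecI)
      fix r assume "r < dim_vec (complex_of_real (class_prob A p j * l j k) \<cdot>\<^sub>v E x)"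
      then have r: "r < card J * d"
        using ket_carrier[OF ket finite_J jk(1)] ec[OF jk] by (simp add: x E_def tensor_vec_def)
      then show "tensor_vec (ket j) (complex_of_real (class_prob A p j) \<cdot>\<^sub>v (complex_of_real (l j k) \<cdot>\<^sub>v e j k)) $ r
          = (complex_of_real (class_prob A p j * l j k) \<cdot>\<^sub>v E x) $ r"
        using ket_carrier[OF ket finite_J jk(1), THEN carrier_vecD] ec[OF jk, THEN carrier_vecD] div_mod_less[OF r]
        by (simp add: x E_def tensor_vec_def)
    qed (simp add: x E_def tensor_vec_def)
    finally show "\<rho> *\<^sub>v E x = complex_of_real (class_prob A p (fst x) * l (fst x) (snd x)) \<cdot>\<^sub>v E x"
      by (simp add: x)
  qed (simp_all add: finite_J)
  also have "(\<Sum>(j, k)\<in>J \<times> {..<d}. class_prob A p j * l j k * log 2 (class_prob A p j * l j k))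
      = (\<Sum>j\<in>J. \<Sum>k<d. class_prob A p j * l j k * log 2 (class_prob A p j * l j k))"
    by (rule sum.cartesian_product[symmetric])
  also have "\<dots> = (\<Sum>j\<in>J. class_prob A p j * log 2 (class_prob A p j)
      - class_prob A p j * vn_entropy (\<sigma> j))"
  proof (intro sum.cong refl)
    fix j assume j: "j \<in> J"
    have "vn_entropy (\<sigma> j) = - (\<Sum>k<d. l j k * log 2 (l j k))"
      by (rule vn_entropy_eigenbasis[OF \<sigma>_carrier e[OF j]]) (use ev[OF j] in auto)
    \<comment> \<open>The logarithm of the product splits; the first part carries the total of the
      \<open>l j k\<close>, which is \<open>1\<close>.\<close>
    moreover have "(\<Sum>k<d. class_prob A p j * l j k * log 2 (class_prob A p j * l j k))
        = (\<Sum>k<d. l j k) * (class_prob A p j * log 2 (class_prob A p j))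
          + class_prob A p j * (\<Sum>k<d. l j k * log 2 (l j k))"
      unfolding sum_distrib_right sum_distrib_left sum.distrib[symmetric]
      by (intro sum.cong refl xlog_mult class_prob_positive[OF j]) (use l0[OF j] in auto)
    ultimately show "(\<Sum>k<d. class_prob A p j * l j k * log 2 (class_prob A p j * l j k))
        = class_prob A p j * log 2 (class_prob A p j) - class_prob A p j * vn_entropy (\<sigma> j)"
      by (simp add: l1[OF j])
  qed
  finally show ?thesis by (simp add: sum_subtractf)
qed

lemma weight_nonneg:
  assumes "projection d P" "j \<in> J"
  shows "0 \<le> weight P j"
  unfolding weight_def using assms projection_cscalar_prod(3) \<phi>_carrier_A p_nonneg_A
  by (intro sum_nonneg mult_nonneg_nonneg) auto

text \<open>The first trace enters outcome probabilities, the second the post-measurement states. On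
  each rank-one summand they are the inner product of \<open>P\<close> applied to
  \<open>\<phi> f\<close> with \<open>\<phi> f\<close> and with itself, which agree for a
  projection. Multiplying by p_j undoes the normalization inside \<open>\<sigma> j\<close>.\<close>

lemma mat_trace_mult_\<sigma>:
  assumes P: "projection d P" and j: "j \<in> J"
  shows "complex_of_real (class_prob A p j) * mat_trace (P * \<sigma> j) = complex_of_real (weight P j)"
    and "complex_of_real (class_prob A p j) * mat_trace (P * \<sigma> j * P) = complex_of_real (weight P j)"
proof -
  have Pc: "P \<in> carrier_mat d d" and Pa: "mat_adjoint P = P" using P by (auto simp: projection_def)
  define c where "c = (\<lambda>f. complex_of_real (p f / class_prob A p j))"
  let ?K = "\<lambda>f. ketbra (\<phi> f) (\<phi> f)"
  have \<sigma>: "\<sigma> j = mat_sum d (A j) (\<lambda>f. c f \<cdot>\<^sub>m ?K f)" unfolding c_def by (rule class_state_eq[OF j])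
  have Kc: "c f \<cdot>\<^sub>m ?K f \<in> carrier_mat d d" if "f \<in> A j" for f by (rule \<sigma>_summand_carrier[OF j that])
  have P\<phi>: "P *\<^sub>v \<phi> f \<in> carrier_vec d" if "f \<in> A j" for f
    using Pc \<phi>_carrier_A[OF j that] by (rule mult_mat_vec_carrier)
  have PK: "P * (c f \<cdot>\<^sub>m ?K f) = c f \<cdot>\<^sub>m ketbra (P *\<^sub>v \<phi> f) (\<phi> f)" if f: "f \<in> A j" for f
    using mult_smult_distrib[OF Pc, of "?K f" d "c f"] mult_ketbra[OF Pc] \<phi>_carrier_A[OF j f] by simp
  have PKP: "P * (c f \<cdot>\<^sub>m ?K f) * P = c f \<cdot>\<^sub>m ketbra (P *\<^sub>v \<phi> f) (P *\<^sub>v \<phi> f)" if f: "f \<in> A j" for f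
    unfolding PK[OF f]
    using mult_smult_assoc_mat[OF _ Pc, of "ketbra (P *\<^sub>v \<phi> f) (\<phi> f)" d "c f"]
      ketbra_mult_adjoint[OF Pc P\<phi>[OF f] \<phi>_carrier_A[OF j f]] P\<phi>[OF f] \<phi>_carrier_A[OF j f] Pa by simp
  have tr: "mat_trace (c f \<cdot>\<^sub>m ketbra (P *\<^sub>v \<phi> f) w) = c f * ((P *\<^sub>v \<phi> f) \<bullet>c w)"
    if "f \<in> A j" "w \<in> carrier_vec d" for f w
    using mat_trace_smult[of "ketbra (P *\<^sub>v \<phi> f) w" d "c f"] mat_trace_ketbra[OF P\<phi>[OF that(1)] that(2)]
      P\<phi>[OF that(1)] that(2) by simp
  have "mat_trace (P * \<sigma> j) = (\<Sum>f\<in>A j. mat_trace (P * (c f \<cdot>\<^sub>m ?K f)))"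
    unfolding \<sigma> using Kc Pc by (subst mult_mat_sum) (auto intro!: mat_trace_mat_sum mult_carrier_mat)
  also have "\<dots> = (\<Sum>f\<in>A j. c f * ((P *\<^sub>v \<phi> f) \<bullet>c \<phi> f))"
    using tr \<phi>_carrier_A[OF j] by (intro sum.cong refl) (simp add: PK)
  finally have 1: "mat_trace (P * \<sigma> j) = (\<Sum>f\<in>A j. c f * ((P *\<^sub>v \<phi> f) \<bullet>c \<phi> f))" .
  have PKc: "P * (c f \<cdot>\<^sub>m ?K f) \<in> carrier_mat d d" if "f \<in> A j" for f
    using Pc Kc[OF that] by (rule mult_carrier_mat)
  have "P * \<sigma> j * P = mat_sum d (A j) (\<lambda>f. P * (c f \<cdot>\<^sub>m ?K f)) * P"
    unfolding \<sigma> by (subst mult_mat_sum[OF Pc Kc]) auto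
  also have "\<dots> = mat_sum d (A j) (\<lambda>f. P * (c f \<cdot>\<^sub>m ?K f) * P)"
    by (rule mat_sum_mult[OF Pc PKc])
  finally have "mat_trace (P * \<sigma> j * P) = (\<Sum>f\<in>A j. mat_trace (P * (c f \<cdot>\<^sub>m ?K f) * P))"
    using mat_trace_mat_sum[of "A j" "\<lambda>f. P * (c f \<cdot>\<^sub>m ?K f) * P" d] mult_carrier_mat[OF PKc Pc] by simp
  also have "\<dots> = (\<Sum>f\<in>A j. c f * ((P *\<^sub>v \<phi> f) \<bullet>c \<phi> f))"
    using tr P\<phi> projection_cscalar_prod(1)[OF P \<phi>_carrier_A[OF j]] by (intro sum.cong refl) (simp add: PKP)
  finally have 2: "mat_trace (P * \<sigma> j * P) = (\<Sum>f\<in>A j. c f * ((P *\<^sub>v \<phi> f) \<bullet>c \<phi> f))" .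
  have "complex_of_real (class_prob A p j) * (\<Sum>f\<in>A j. c f * ((P *\<^sub>v \<phi> f) \<bullet>c \<phi> f))
      = (\<Sum>f\<in>A j. complex_of_real (p f * Re ((P *\<^sub>v \<phi> f) \<bullet>c \<phi> f)))"
    unfolding sum_distrib_left
  proof (intro sum.cong refl)
    fix f assume f: "f \<in> A j"
    have "complex_of_real (class_prob A p j) * c f = complex_of_real (p f)"
      using class_prob_positive[OF j] by (simp add: c_def)
    then show "complex_of_real (class_prob A p j) * (c f * ((P *\<^sub>v \<phi> f) \<bullet>c \<phi> f))
        = complex_of_real (p f * Re ((P *\<^sub>v \<phi> f) \<bullet>c \<phi> f))"
      using projection_cscalar_prod(2)[OF P \<phi>_carrier_A[OF j f]] by (simp add: mult.assoc[symmetric])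
  qed
  then have "complex_of_real (class_prob A p j) * (\<Sum>f\<in>A j. c f * ((P *\<^sub>v \<phi> f) \<bullet>c \<phi> f))
      = complex_of_real (weight P j)" by (simp add: weight_def)
  then show "complex_of_real (class_prob A p j) * mat_trace (P * \<sigma> j) = complex_of_real (weight P j)"
    "complex_of_real (class_prob A p j) * mat_trace (P * \<sigma> j * P) = complex_of_real (weight P j)"
    unfolding 1 2 by simp_all
qed

lemma outcome_prob_eq:
  assumes P: "projection d P"
  shows "outcome_prob (card J) \<rho> P = (\<Sum>j\<in>J. weight P j)"
proof -
  have Pc: "P \<in> carrier_mat d d" by (rule projection_carrier[OF P])
  have "mat_trace (tensor_mat (1\<^sub>m (card J)) P * \<rho>)
      = (\<Sum>j\<in>J. complex_of_real (class_prob A p j) * mat_trace (P * \<sigma> j))"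
    unfolding \<rho>_cq tensor_one_mult_cq_mat[OF ket finite_J \<sigma>_carrier Pc]
    by (rule mat_trace_cq_mat[OF ket finite_J mult_carrier_mat[OF Pc \<sigma>_carrier]])
  then show ?thesis by (simp add: outcome_prob_def mat_trace_mult_\<sigma>[OF P])
qed

text \<open>The partial trace is diagonal in the kets, with the weights as entries. If the outcome
  has probability \<open>0\<close>, both sides are \<open>0\<close> because division by zero yields
  \<open>0\<close>.\<close>

lemma vn_entropy_post_state:
  assumes P: "projection d P"
  shows "vn_entropy (post_state (card J) d \<rho> P)
    = - (\<Sum>j\<in>J. weight P j / outcome_prob (card J) \<rho> P * log 2 (weight P j / outcome_prob (card J) \<rho> P))"
proof -
  have Pc: "P \<in> carrier_mat d d" by (rule projection_carrier[OF P])
  have "ptrace_right (card J) d (tensor_mat (1\<^sub>m (card J)) P * \<rho> * tensor_mat (1\<^sub>m (card J)) P)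
      = mat_sum (card J) J (\<lambda>j. (complex_of_real (class_prob A p j) * mat_trace (P * \<sigma> j * P)) \<cdot>\<^sub>m ketbra (ket j) (ket j))"
    unfolding \<rho>_cq tensor_one_mult_cq_mat[OF ket finite_J \<sigma>_carrier Pc]
      cq_mat_mult_tensor_one[OF ket finite_J mult_carrier_mat[OF Pc \<sigma>_carrier] Pc]
    by (rule ptrace_right_cq_mat[OF ket finite_J mult_carrier_mat[OF mult_carrier_mat[OF Pc \<sigma>_carrier] Pc]])
  also have "\<dots> = mat_sum (card J) J (\<lambda>j. complex_of_real (weight P j) \<cdot>\<^sub>m ketbra (ket j) (ket j))"
    by (rule mat_sum_cong) (simp add: mat_trace_mult_\<sigma>[OF P])
  finally show ?thesis
    using vn_entropy_scaled_sum_ketbra[OF ket finite_J, of "1 / outcome_prob (card J) \<rho> P" "weight P"]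
    by (simp add: post_state_def)
qed

text \<open>The projections sum to the identity and every \<open>\<phi> f\<close> is a unit vector,
  so the marginal on \<open>J\<close> is the same for all measurements.\<close>

lemma sum_weight_measurement:
  assumes Ps: "projective_measurement d Ps" and j: "j \<in> J"
  shows "(\<Sum>k<length Ps. weight (Ps ! k) j) = class_prob A p j"
proof -
  have "(\<Sum>k<length Ps. Re ((Ps ! k *\<^sub>v \<phi> f) \<bullet>c \<phi> f)) = 1" if f: "f \<in> A j" for f
  proof -
    have \<phi>: "\<phi> f \<in> carrier_vec d" "\<phi> f \<bullet>c \<phi> f = 1"
      using \<phi>_carrier_A[OF j f] \<phi>_normalized[of f] A_subset[OF j] f by auto
    have "(\<Sum>k<length Ps. (Ps ! k *\<^sub>v \<phi> f) \<bullet>c \<phi> f) = (mat_sum d {..<length Ps} ((!) Ps) *\<^sub>v \<phi> f) \<bullet>c \<phi> f"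
      using Ps by (intro mat_sum_mult_vec_cscalar_prod[symmetric] \<phi>) (auto simp: projective_measurement_def)
    also have "\<dots> = 1" using Ps \<phi> by (simp add: projective_measurement_def)
    finally show ?thesis by (metis Re_sum one_complex.simps(1))
  qed
  then show ?thesis
    unfolding weight_def class_prob_def
    by (subst sum.swap) (simp add: sum_distrib_left[symmetric])
qed

text \<open>The entropy of the average state cancels, and so do the entropies of the
  \<open>\<sigma> j\<close> against those inside \<open>vn_entropy \<rho>\<close>. What remains is
  \<open>H(J)\<close> minus the average entropy of \<open>J\<close> after the outcome, that is
  \<open>H(J) - H(J|K)\<close>.\<close>

lemma holevo_minus_discord_meas:
  assumes Ps: "projective_measurement d Ps"
  shows "holevo d J (class_prob A p) \<sigma> - discord_meas (card J) d \<rho> Ps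
    = info J {..<length Ps} (\<lambda>j k. weight (Ps ! k) j)"
proof -
  let ?w = "\<lambda>j k. weight (Ps ! k) j" and ?K = "{..<length Ps}" and ?h = "\<lambda>x. x * log 2 x"
  define q where "q = (\<lambda>k. outcome_prob (card J) \<rho> (Ps ! k))"
  have proj: "projection d (Ps ! k)" if "k < length Ps" for k by (rule projective_measurementD[OF Ps that])
  have w0: "0 \<le> ?w j k" if "j \<in> J" "k < length Ps" for j k by (rule weight_nonneg[OF proj[OF that(2)] that(1)])
  have q: "q k = (\<Sum>j\<in>J. ?w j k)" if "k < length Ps" for k
    unfolding q_def by (rule outcome_prob_eq[OF proj[OF that]])
  have wq: "?w j k \<le> q k" if "j \<in> J" "k < length Ps" for j k
    unfolding q[OF that(2)] using that w0 finite_J by (intro member_le_sum) auto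
  have "(\<Sum>k\<in>{k. k < length Ps \<and> q k \<noteq> 0}. q k * vn_entropy (post_state (card J) d \<rho> (Ps ! k)))
      = (\<Sum>k\<in>{k. k < length Ps \<and> q k \<noteq> 0}. \<Sum>j\<in>J. - (?h (?w j k) - ?w j k * log 2 (q k)))"
  proof (intro sum.cong refl)
    fix k assume k: "k \<in> {k. k < length Ps \<and> q k \<noteq> 0}"
    have "q k * vn_entropy (post_state (card J) d \<rho> (Ps ! k))
        = (\<Sum>j\<in>J. - (?w j k * log 2 (?w j k / q k)))"
      unfolding vn_entropy_post_state[OF proj[of k, OF k[simplified, THEN conjunct1]]]
      using k by (simp add: q_def sum_distrib_left sum_negf)
    also have "\<dots> = (\<Sum>j\<in>J. - (?h (?w j k) - ?w j k * log 2 (q k)))"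
      using k w0 wq by (intro sum.cong refl arg_cong[where f = uminus] xlog_div) auto
    finally show "q k * vn_entropy (post_state (card J) d \<rho> (Ps ! k))
        = (\<Sum>j\<in>J. - (?h (?w j k) - ?w j k * log 2 (q k)))" .
  qed
  \<comment> \<open>The discord omits outcomes of probability \<open>0\<close>. They can be restored
    because all their weights vanish.\<close>
  also have "\<dots> = (\<Sum>k\<in>?K. \<Sum>j\<in>J. - (?h (?w j k) - ?w j k * log 2 (q k)))"
  proof (rule sum.mono_neutral_left)
    show "\<forall>k\<in>?K - {k. k < length Ps \<and> q k \<noteq> 0}. (\<Sum>j\<in>J. - (?h (?w j k) - ?w j k * log 2 (q k))) = 0"
    proof
      fix k assume "k \<in> ?K - {k. k < length Ps \<and> q k \<noteq> 0}"
      then have k: "k < length Ps" "q k = 0" by auto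
      have "?w j k = 0" if "j \<in> J" for j using w0[OF that k(1)] wq[OF that k(1)] k(2) by simp
      then show "(\<Sum>j\<in>J. - (?h (?w j k) - ?w j k * log 2 (q k))) = 0" by simp
    qed
  qed auto
  also have "\<dots> = (\<Sum>k\<in>?K. ?h (q k)) - (\<Sum>j\<in>J. \<Sum>k\<in>?K. ?h (?w j k))"
    by (subst (2) sum.swap) (simp add: q sum_negf sum_subtractf sum_distrib_right)
  finally have post: "(\<Sum>k\<in>{k. k < length Ps \<and> outcome_prob (card J) \<rho> (Ps ! k) \<noteq> 0}.
      outcome_prob (card J) \<rho> (Ps ! k) * vn_entropy (post_state (card J) d \<rho> (Ps ! k)))
      = (\<Sum>k\<in>?K. ?h (q k)) - (\<Sum>j\<in>J. \<Sum>k\<in>?K. ?h (?w j k))" unfolding q_def .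
  have "info J ?K ?w = (\<Sum>j\<in>J. \<Sum>k\<in>?K. ?h (?w j k)) - (\<Sum>j\<in>J. ?h (class_prob A p j)) - (\<Sum>k\<in>?K. ?h (q k))"
    using info_eq_entropies[OF finite_J, of ?K ?w] w0 by (simp add: q sum_weight_measurement[OF Ps])
  moreover have "ptrace_left (card J) d \<rho> = mat_sum d J (\<lambda>j. complex_of_real (class_prob A p j) \<cdot>\<^sub>m \<sigma> j)"
    unfolding \<rho>_cq by (rule ptrace_left_cq_mat[OF ket finite_J \<sigma>_carrier])
  ultimately show ?thesis
    unfolding holevo_def discord_meas_def post vn_entropy_\<rho> by simp
qed

section \<open>Classical statistics of the computational basis outcome after
  \<open>W\<close>\<close>

definition output_prob :: "complex mat \<Rightarrow> 'j \<Rightarrow> nat \<Rightarrow> real" where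
  "output_prob W j y = (\<Sum>f\<in>A j. p f * (cmod ((W *\<^sub>v \<phi> f) $ y))\<^sup>2)"

lemma output_prob_nonneg: "j \<in> J \<Longrightarrow> 0 \<le> output_prob W j y"
  unfolding output_prob_def using p_nonneg_A by (intro sum_nonneg) simp

lemma sum_classes: "(\<Sum>f\<in>F. g f) = (\<Sum>j\<in>J. \<Sum>f\<in>A j. (g f :: real))"
  unfolding Union_classes[symmetric] using finite_A disjoint_classes
  by (intro sum.UNION_disjoint finite_J) (auto simp: disjoint_family_on_def)

text \<open>The measure is a finite point measure, so the measure-theoretic mutual information
  becomes a finite sum once the fibres of class, outcome and pair have been measured.\<close>

lemma mutual_info_eq_info:
  assumes W: "unitary_mat d W"
  shows "mutual_info F J A n m U p \<psi> W = info J {..<d} (output_prob W)"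
proof -
  define c where "c = (\<lambda>f y. (cmod ((W *\<^sub>v \<phi> f) $ y))\<^sup>2)"
  have Wc: "W \<in> carrier_mat d d" using W by (simp add: unitary_mat_def)
  have cond: "cond_prob n m U \<psi> W f y = c f y" if "f \<in> F" "y < d" for f y
    unfolding cond_prob_def c_def \<phi>_def[symmetric]
    using cscalar_prod_unit_vec[OF mult_mat_vec_carrier[OF Wc \<phi>_carrier[OF that(1)]] that(2)] by simp
  have c1: "(\<Sum>y<d. c f y) = 1" if "f \<in> F" for f
    unfolding c_def unitary_norm[OF W \<phi>_carrier[OF that]] using \<phi>_normalized[OF that] by simp
  define g where "g = (\<lambda>(f, y). p f * c f y)"
  define M where "M = point_measure (F \<times> {..<d}) (\<lambda>x. ennreal (g x))"
  have g0: "0 \<le> g x" if "x \<in> F \<times> {..<d}" for x using that p_nonneg by (auto simp: g_def c_def)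
  have M: "joint_measure F n m U p \<psi> W = M"
    unfolding joint_measure_def M_def point_measure_def
    by (intro density_cong) (auto simp: g_def cond AE_count_space)
  have space: "space M = F \<times> {..<d}" by (simp add: M_def space_point_measure)
  have fin: "finite (F \<times> {..<d})" using finite_F by simp
  have meas: "measure M X = sum g X" if "X \<subseteq> F \<times> {..<d}" for X
    unfolding M_def using measure_point_measure_finite_if[OF fin, of g X] g0 that by auto
  have "sum g (F \<times> {..<d}) = (\<Sum>f\<in>F. p f * (\<Sum>y<d. c f y))"
    by (simp add: g_def sum.cartesian_product[symmetric] sum_distrib_left)
  also have "\<dots> = 1" using c1 sum_p by simp
  finally have total: "sum g (F \<times> {..<d}) = 1" .
  have "prob_space M"
  proof (rule prob_spaceI)
    have "emeasure M (space M) = (\<Sum>x\<in>F \<times> {..<d}. ennreal (g x))"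
      unfolding space unfolding M_def by (rule emeasure_point_measure_finite[OF fin order_refl])
    also have "\<dots> = 1" using g0 by (subst sum_ennreal) (auto simp: total)
    finally show "emeasure M (space M) = 1" .
  qed
  then interpret prob_space M .
  interpret information_space M 2 by standard simp
  let ?X = "\<lambda>(f, y). class_index J A f" and ?Y = "\<lambda>(f, y). y"
  have idx: "class_index J A f \<in> J \<and> f \<in> A (class_index J A f)" if "f \<in> F" for f
    using that Union_classes class_index_eq by auto
  have "F \<noteq> {}" using sum_p by auto
  \<comment> \<open>The formula for simple distributions uses the images of the variables as value
    spaces, so they must equal \<open>J\<close> and \<open>{..<d}\<close> exactly. A class is
    attained by any member, even one with \<open>p f = 0\<close>.\<close>
  have XJ: "?X ` space M = J"
  proof
    show "?X ` space M \<subseteq> J" using idx by (auto simp: space)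
    show "J \<subseteq> ?X ` space M"
    proof
      fix j assume j: "j \<in> J"
      obtain f where f: "f \<in> A j" using class_nonempty[OF j] by auto
      then have "(f, 0) \<in> space M" using A_subset[OF j] by (auto simp: space)
      moreover have "?X (f, 0) = j" using class_index_eq[OF j f] by simp
      ultimately show "j \<in> ?X ` space M" by (metis imageI)
    qed
  qed
  have YK: "?Y ` space M = {..<d}" using \<open>F \<noteq> {}\<close> by (force simp: space)
  have XYJ: "(\<lambda>x. (?X x, ?Y x)) ` space M = J \<times> {..<d}"
  proof
    show "(\<lambda>x. (?X x, ?Y x)) ` space M \<subseteq> J \<times> {..<d}" using idx by (auto simp: space)
    show "J \<times> {..<d} \<subseteq> (\<lambda>x. (?X x, ?Y x)) ` space M"
    proof clarsimp
      fix j y assume j: "j \<in> J" and y: "y < d"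
      obtain f where f: "f \<in> A j" using class_nonempty[OF j] by auto
      then have "(f, y) \<in> space M" using A_subset[OF j] y by (auto simp: space)
      moreover have "(j, y) = (?X (f, y), ?Y (f, y))" using class_index_eq[OF j f] by simp
      ultimately show "(j, y) \<in> (\<lambda>x. (?X x, ?Y x)) ` space M" by (rule rev_image_eqI)
    qed
  qed
  have sf: "simple_function M h" if "finite (h ` space M)" for h :: "'f \<times> nat \<Rightarrow> 'x"
    using that unfolding M_def by (simp add: space_point_measure)
  have "finite (?X ` space M)" "finite (?Y ` space M)" "finite ((\<lambda>x. (?X x, ?Y x)) ` space M)"
    unfolding XJ YK XYJ using finite_J by auto
  \<comment> \<open>For class, outcome and pair in turn, the probability function is taken to be the
    measure of each fibre.\<close>
  note sd = simple_distributedI[OF sf measure_nonneg refl, OF this(1)]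
    simple_distributedI[OF sf measure_nonneg refl, OF this(2)]
    simple_distributedI[OF sf measure_nonneg refl, OF this(3)]
  have PX: "measure M (?X -` {j} \<inter> space M) = (\<Sum>y<d. output_prob W j y)" if j: "j \<in> J" for j
  proof -
    have "?X -` {j} \<inter> space M = A j \<times> {..<d}"
      using idx class_index_eq[OF j] subsetD[OF A_subset[OF j]] by (auto simp: space)
    moreover have "sum g (A j \<times> {..<d}) = (\<Sum>y<d. output_prob W j y)"
      unfolding output_prob_def c_def[symmetric]
      by (subst sum.swap) (simp add: g_def sum.cartesian_product[symmetric] c_def)
    ultimately show ?thesis using meas[of "A j \<times> {..<d}"] A_subset[OF j] by auto
  qed
  have PY: "measure M (?Y -` {y} \<inter> space M) = (\<Sum>j\<in>J. output_prob W j y)" if y: "y < d" for y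
  proof -
    have "?Y -` {y} \<inter> space M = F \<times> {y}" using y by (auto simp: space)
    moreover have "sum g (F \<times> {y}) = (\<Sum>f\<in>F. p f * c f y)"
      by (simp add: g_def sum.cartesian_product[symmetric])
    ultimately show ?thesis using meas[of "F \<times> {y}"] y by (auto simp: sum_classes output_prob_def c_def)
  qed
  have PXY: "measure M ((\<lambda>x. (?X x, ?Y x)) -` {(j, y)} \<inter> space M) = output_prob W j y"
    if j: "j \<in> J" and y: "y < d" for j y
  proof -
    have "(\<lambda>x. (?X x, ?Y x)) -` {(j, y)} \<inter> space M = A j \<times> {y}"
      using idx class_index_eq[OF j] subsetD[OF A_subset[OF j]] y by (auto simp: space)
    moreover have "sum g (A j \<times> {y}) = output_prob W j y"
      by (simp add: g_def sum.cartesian_product[symmetric] output_prob_def c_def)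
    ultimately show ?thesis using meas[of "A j \<times> {y}"] A_subset[OF j] y by auto
  qed
  have "mutual_info F J A n m U p \<psi> W = mutual_information 2 (count_space (?X ` space M)) (count_space (?Y ` space M)) ?X ?Y"
    unfolding mutual_info_def M XJ YK ..
  also have "\<dots> = (\<Sum>(j, y)\<in>J \<times> {..<d}. output_prob W j y
      * log 2 (output_prob W j y / ((\<Sum>y<d. output_prob W j y) * (\<Sum>j\<in>J. output_prob W j y))))"
    unfolding mutual_information_simple_distributed[OF sd] XYJ
    by (intro sum.cong refl) (auto simp: PX PY PXY)
  also have "\<dots> = info J {..<d} (output_prob W)"
    unfolding info_def by (rule sum.cartesian_product[symmetric])
  finally show ?thesis .
qed

lemma unitary_measurement:
  assumes W: "unitary_mat d W"
  obtains Ps where "projective_measurement d Ps" "length Ps = d"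
    "\<And>j y. j \<in> J \<Longrightarrow> y < d \<Longrightarrow> weight (Ps ! y) j = output_prob W j y"
proof -
  have Wc: "W \<in> carrier_mat d d" and WW: "W * mat_adjoint W = 1\<^sub>m d" using W by (auto simp: unitary_mat_def)
  \<comment> \<open>\<open>v y\<close> is the adjoint of \<open>W\<close> applied to the basis
    vector \<open>y\<close>, that is the conjugated row \<open>y\<close> of \<open>W\<close>; a
    scalar product with it reads off coordinate \<open>y\<close> of the output.\<close>
  define v where "v = (\<lambda>y. Matrix.vec d (\<lambda>i. cnj (W $$ (y, i))))"
  have vc: "v y \<in> carrier_vec d" for y by (simp add: v_def)
  have vi: "v y $ i = cnj (W $$ (y, i))" if "i < d" for y i using that by (simp add: v_def)
  have xv: "x \<bullet>c v y = (W *\<^sub>v x) $ y" if "x \<in> carrier_vec d" "y < d" for x y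
    using that by (simp add: cscalar_prod_sum[OF vc] mult_mat_vec_index[OF Wc] vi mult.commute)
  have vv: "v y \<bullet>c v z = (if y = z then 1 else 0)" if yz: "y < d" "z < d" for y z
  proof -
    have "v y \<bullet>c v z = (\<Sum>i<d. W $$ (z, i) * mat_adjoint W $$ (i, y))"
      using yz by (simp add: cscalar_prod_sum[OF vc] vi mat_adjoint_index[OF Wc] mult.commute)
    also have "\<dots> = (W * mat_adjoint W) $$ (z, y)"
      by (rule mult_mat_index[OF Wc mat_adjoint_carrier[OF Wc] yz(2,1), symmetric])
    finally show ?thesis using WW yz by auto
  qed
  then have onb: "orthonormal_on d {..<d} v" using vc by (simp add: orthonormal_on_def)
  define Ps where "Ps = map (\<lambda>y. ketbra (v y) (v y)) [0..<d]"
  have len: "length Ps = d" by (simp add: Ps_def)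
  have nth: "Ps ! y = ketbra (v y) (v y)" if "y < d" for y using that by (simp add: Ps_def)
  have "projective_measurement d Ps"
    unfolding projective_measurement_def len
  proof (intro conjI allI impI)
    fix y assume y: "y < d"
    show "Ps ! y \<in> carrier_mat d d" "mat_adjoint (Ps ! y) = Ps ! y"
      using nth[OF y] vc mat_adjoint_ketbra[OF vc vc] by auto
    fix z assume z: "z < d"
    have "Ps ! y * Ps ! z = ketbra ((v z \<bullet>c v y) \<cdot>\<^sub>v v y) (v z)"
      unfolding nth[OF y] nth[OF z] using mult_ketbra[OF ketbra_carrier[OF vc vc] vc vc]
      by (simp add: ketbra_mult_vec[OF vc vc vc])
    also have "\<dots> = (if y = z then Ps ! y else 0\<^sub>m d d)"
    proof (cases "y = z")
      case True
      then show ?thesis using vv[OF z z] nth[OF z] by simp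
    next
      case False
      have "ketbra (0 \<cdot>\<^sub>v v y) (v z) = 0\<^sub>m d d"
        using vc[of y, THEN carrier_vecD] vc[of z, THEN carrier_vecD] by (intro eq_matI) (auto simp: ketbra_def)
      then show ?thesis using False vv[OF z y] by simp
    qed
    finally show "Ps ! y * Ps ! z = (if y = z then Ps ! y else 0\<^sub>m d d)" .
  next
    show "mat_sum d {..<d} ((!) Ps) = 1\<^sub>m d"
    proof (rule eq_matI)
      fix r s assume "r < dim_row (1\<^sub>m d :: complex mat)" "s < dim_col (1\<^sub>m d :: complex mat)"
      then have rs: "r < d" "s < d" by auto
      have "mat_sum d {..<d} ((!) Ps) $$ (r, s) = (\<Sum>y<d. v y $ r * cnj (v y $ s))"
        using rs by (simp add: mat_sum_index nth ketbra_index[OF vc vc])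
      then show "mat_sum d {..<d} ((!) Ps) $$ (r, s) = 1\<^sub>m d $$ (r, s)"
        using orthonormal_on_completeness[OF onb finite_lessThan card_lessThan rs] rs by simp
    qed (auto simp: mat_sum_def)
  qed
  moreover have "weight (Ps ! y) j = output_prob W j y" if j: "j \<in> J" and y: "y < d" for j y
    unfolding weight_def output_prob_def
  proof (intro sum.cong refl)
    fix f assume f: "f \<in> A j"
    have \<phi>: "\<phi> f \<in> carrier_vec d" by (rule \<phi>_carrier_A[OF j f])
    have "(Ps ! y *\<^sub>v \<phi> f) \<bullet>c \<phi> f = (\<phi> f \<bullet>c v y) * cnj (\<phi> f \<bullet>c v y)"
      unfolding nth[OF y] ketbra_mult_vec[OF vc vc \<phi>] cscalar_prod_swap[OF \<phi> vc, symmetric]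
      using vc \<phi> by (simp add: cscalar_prod_smult)
    also have "\<dots> = complex_of_real ((cmod ((W *\<^sub>v \<phi> f) $ y))\<^sup>2)"
      unfolding xv[OF \<phi> y] complex_norm_square ..
    finally show "p f * Re ((Ps ! y *\<^sub>v \<phi> f) \<bullet>c \<phi> f) = p f * (cmod ((W *\<^sub>v \<phi> f) $ y))\<^sup>2" by simp
  qed
  ultimately show ?thesis using that[of Ps] len by blast
qed

text \<open>In the refining basis each \<open>Ps ! k\<close> is diagonal with entries
  \<open>0\<close> and \<open>1\<close>, so its weights are the output probabilities summed over the
  fibre of \<open>g\<close> at \<open>k\<close>. The inequality is then coarse-graining along
  \<open>g\<close>.\<close>

lemma measurement_refinement:
  assumes Ps: "projective_measurement d Ps"
  obtains W where "unitary_mat d W"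
    "info J {..<length Ps} (\<lambda>j k. weight (Ps ! k) j) \<le> info J {..<d} (output_prob W)"
proof -
  obtain e g where e: "orthonormal_on d {..<d} e" and g: "\<forall>y<d. g y < length Ps"
    and Pe: "\<forall>y<d. \<forall>k<length Ps. Ps ! k *\<^sub>v e y = (if k = g y then 1 else 0) \<cdot>\<^sub>v e y"
    using measurement_eigenbasis[OF Ps] by blast
  have ec: "e y \<in> carrier_vec d" if "y < d" for y
    using e that by (simp_all add: orthonormal_on_def)
  \<comment> \<open>With the conjugated basis vectors as rows, \<open>W\<close> maps a vector to its
    coordinates in the basis \<open>e\<close>.\<close>
  define W where "W = Matrix.mat d d (\<lambda>(y, i). cnj (e y $ i))"
  have Wc: "W \<in> carrier_mat d d" by (simp add: W_def)
  have Wi: "W $$ (y, i) = cnj (e y $ i)" if "y < d" "i < d" for y i using that by (simp add: W_def)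
  have WW: "W * mat_adjoint W = 1\<^sub>m d"
  proof (rule eq_matI)
    fix y z assume "y < dim_row (1\<^sub>m d :: complex mat)" "z < dim_col (1\<^sub>m d :: complex mat)"
    then have yz: "y < d" "z < d" by auto
    have "(W * mat_adjoint W) $$ (y, z) = e z \<bullet>c e y"
      unfolding mult_mat_index[OF Wc mat_adjoint_carrier[OF Wc] yz] cscalar_prod_sum[OF ec[OF yz(1)]]
      using yz by (intro sum.cong) (auto simp: mat_adjoint_index[OF Wc] Wi)
    then show "(W * mat_adjoint W) $$ (y, z) = 1\<^sub>m d $$ (y, z)"
      using e yz by (auto simp: orthonormal_on_def)
  qed (use Wc in \<open>auto simp: mat_adjoint_def\<close>)
  then have unitary: "unitary_mat d W"
    using mat_mult_left_right_inverse[OF Wc mat_adjoint_carrier[OF Wc]] Wc by (simp add: unitary_mat_def)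
  have Wx: "(W *\<^sub>v x) $ y = x \<bullet>c e y" if "x \<in> carrier_vec d" "y < d" for x y
    using that by (simp add: mult_mat_vec_index[OF Wc] cscalar_prod_sum[OF ec] Wi mult.commute)
  have "weight (Ps ! k) j = (\<Sum>y\<in>{y \<in> {..<d}. g y = k}. output_prob W j y)"
    if j: "j \<in> J" and k: "k \<in> {..<length Ps}" for j k
  proof -
    have P: "Ps ! k \<in> carrier_mat d d" "mat_adjoint (Ps ! k) = Ps ! k"
      using Ps k by (auto simp: projective_measurement_def)
    have "Re ((Ps ! k *\<^sub>v \<phi> f) \<bullet>c \<phi> f) = (\<Sum>y\<in>{y \<in> {..<d}. g y = k}. (cmod ((W *\<^sub>v \<phi> f) $ y))\<^sup>2)"
      if f: "f \<in> A j" for f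
    proof -
      have \<phi>: "\<phi> f \<in> carrier_vec d" by (rule \<phi>_carrier_A[OF j f])
      have P\<phi>: "Ps ! k *\<^sub>v \<phi> f \<in> carrier_vec d" using P(1) \<phi> by (rule mult_mat_vec_carrier)
      \<comment> \<open>Parseval expands the expectation in the basis \<open>e\<close>;
        self-adjointness moves the projection onto \<open>e y\<close>, where it acts as
        \<open>0\<close> or \<open>1\<close>.\<close>
      have "(Ps ! k *\<^sub>v \<phi> f) \<bullet>c \<phi> f
          = (\<Sum>y<d. if g y = k then complex_of_real ((cmod ((W *\<^sub>v \<phi> f) $ y))\<^sup>2) else 0)"
        unfolding parseval[OF e finite_lessThan card_lessThan P\<phi> \<phi>]
      proof (intro sum.cong refl)
        fix y assume "y \<in> {..<d}"
        then have y: "y < d" by simp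
        have "(Ps ! k *\<^sub>v \<phi> f) \<bullet>c e y = \<phi> f \<bullet>c ((if k = g y then 1 else 0) \<cdot>\<^sub>v e y)"
          using cscalar_prod_adjoint[OF P(1) \<phi> ec[OF y]] P(2) Pe y k by simp
        also have "\<dots> = (if g y = k then \<phi> f \<bullet>c e y else 0)"
          using ec[OF y] \<phi> by (auto simp: cscalar_prod_sum[of _ d])
        finally show "((Ps ! k *\<^sub>v \<phi> f) \<bullet>c e y) * (e y \<bullet>c \<phi> f)
            = (if g y = k then complex_of_real ((cmod ((W *\<^sub>v \<phi> f) $ y))\<^sup>2) else 0)"
          unfolding cscalar_prod_swap[OF \<phi> ec[OF y]] complex_norm_square Wx[OF \<phi> y] by simp
      qed
      also have "\<dots> = complex_of_real (\<Sum>y\<in>{y \<in> {..<d}. g y = k}. (cmod ((W *\<^sub>v \<phi> f) $ y))\<^sup>2)"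
        unfolding of_real_sum by (rule sum.inter_filter[symmetric]) simp
      finally show ?thesis by simp
    qed
    then show ?thesis
      unfolding weight_def output_prob_def by (subst sum.swap) (simp add: sum_distrib_left)
  qed
  then have "info J {..<length Ps} (\<lambda>j k. weight (Ps ! k) j)
      = info J {..<length Ps} (\<lambda>j k. \<Sum>y\<in>{y \<in> {..<d}. g y = k}. output_prob W j y)"
    by (rule info_cong)
  also have "\<dots> \<le> info J {..<d} (output_prob W)"
    using g output_prob_nonneg by (intro info_coarse_le finite_J) auto
  finally show ?thesis using that[OF unitary] by simp
qed

text \<open>Each output probability is a finite combination of squared moduli of linear forms in the
  coefficients, hence continuous; \<open>info\<close> preserves continuity even where probabilities
  vanish, so the supremum over the compact coefficient set is attained.\<close>

lemma exists_optimal_unitary: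
  obtains W where "unitary_mat d W"
    "\<And>W'. unitary_mat d W' \<Longrightarrow> info J {..<d} (output_prob W') \<le> info J {..<d} (output_prob W)"
proof -
  let ?f = "\<lambda>X. info J {..<d} (output_prob (Matrix.mat d d X))"
  have eq: "output_prob (Matrix.mat d d X) j y = (\<Sum>f\<in>A j. p f * (cmod (\<Sum>i<d. X (y, i) * \<phi> f $ i))\<^sup>2)"
    if "j \<in> J" "y < d" for X j y
    unfolding output_prob_def
  proof (intro sum.cong refl)
    fix f assume "f \<in> A j"
    then have "\<phi> f \<in> carrier_vec d" by (rule \<phi>_carrier_A[OF that(1)])
    then show "p f * (cmod ((Matrix.mat d d X *\<^sub>v \<phi> f) $ y))\<^sup>2 = p f * (cmod (\<Sum>i<d. X (y, i) * \<phi> f $ i))\<^sup>2"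
      using that(2) by (simp add: mult_mat_vec_index[of _ d d])
  qed
  have cont: "continuous_on (unitary_coeffs d) ?f"
  proof (rule continuous_on_info[OF finite_J finite_lessThan])
    fix j y assume jy: "j \<in> J" "y \<in> {..<d}"
    have "continuous_on UNIV (\<lambda>X. \<Sum>f\<in>A j. p f * (cmod (\<Sum>i<d. X (y, i) * \<phi> f $ i))\<^sup>2)"
      by (intro continuous_on_sum continuous_on_mult continuous_on_power continuous_on_norm
          continuous_on_product_coordinates continuous_on_const)
    then show "continuous_on (unitary_coeffs d) (\<lambda>X. output_prob (Matrix.mat d d X) j y)"
      using jy by (simp add: eq continuous_on_subset[OF _ subset_UNIV])
  qed (rule output_prob_nonneg)
  have one: "mat_adjoint (1\<^sub>m d :: complex mat) = 1\<^sub>m d"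
    by (rule eq_matI) (auto simp: mat_adjoint_index[OF one_carrier_mat], auto simp: mat_adjoint_def)
  then have "unitary_mat d (1\<^sub>m d)" by (simp add: unitary_mat_def)
  then have "unitary_coeffs d \<noteq> {}" by (rule ex_in_conv[THEN iffD1, OF exI, OF coeffs_unitary_mat])
  from continuous_attains_sup[OF compact_unitary_coeffs this cont]
  obtain X where X: "X \<in> unitary_coeffs d" and max: "\<forall>Z\<in>unitary_coeffs d. ?f Z \<le> ?f X"
    by (elim bexE)
  show ?thesis
  proof (rule that[OF unitary_mat_coeffs[OF X]])
    fix W assume W: "unitary_mat d W"
    \<comment> \<open>Truncating the coefficients outside the block does not change the matrix, so
      the maximum over coefficient functions dominates every unitary.\<close>
    let ?Z = "\<lambda>(i, j). if i < d \<and> j < d then W $$ (i, j) else 0"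
    have "Matrix.mat d d ?Z = W" using W by (intro eq_matI) (auto simp: unitary_mat_def)
    moreover have "?f ?Z \<le> ?f X" using max coeffs_unitary_mat[OF W] by (rule bspec)
    ultimately show "info J {..<d} (output_prob W) \<le> ?f X" by (simp only:)
  qed
qed

end

theorem mainTheorem3:
  fixes F :: "'f set" and J :: "'j set" and A :: "'j \<Rightarrow> 'f set"
    and m n :: nat and U :: "'f \<Rightarrow> complex mat" and p :: "'f \<Rightarrow> real"
    and \<psi> :: "complex vec" and ket :: "'j \<Rightarrow> complex vec"
  assumes "oracle_classification F J A m U p"
    and "n \<ge> m"
    and "pure_state n \<psi>"
    and "orthonormal_on (card J) J ket"
  shows "(\<exists>W. is_arg_max (mutual_info F J A n m U p \<psi>) (unitary_mat (2 ^ n)) W)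
    \<and> (\<exists>Ps. is_arg_min (discord_meas (card J) (2 ^ n) (joint_state J A n m U p \<psi> ket))
              (projective_measurement (2 ^ n)) Ps)
    \<and> I_max F J A n m U p \<psi> =
        holevo (2 ^ n) J (class_prob A p) (class_state A n m U p \<psi>)
          - discord (card J) (2 ^ n) (joint_state J A n m U p \<psi> ket)"
proof -
  interpret oracle_measurement F J A m U p n \<psi> ket
    using assms by (intro oracle_measurement.intro oracle_measurement_axioms.intro)
  let ?I = "mutual_info F J A n m U p \<psi>" and ?D = "discord_meas (card J) d \<rho>"
    and ?\<chi> = "holevo d J (class_prob A p) \<sigma>"
  obtain W where W: "unitary_mat d W" and max: "\<And>W'. unitary_mat d W' \<Longrightarrow> ?I W' \<le> ?I W"
    using exists_optimal_unitary by (metis mutual_info_eq_info)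
  obtain Ps where Ps: "projective_measurement d Ps" and len: "length Ps = d"
    and w: "\<And>j y. j \<in> J \<Longrightarrow> y < d \<Longrightarrow> weight (Ps ! y) j = output_prob W j y"
    using unitary_measurement[OF W] by blast
  \<comment> \<open>The measurement induced by the optimal \<open>W\<close> turns its mutual
    information into a value of the discord; it is the candidate minimizer.\<close>
  have "?\<chi> - ?D Ps = info J {..<d} (output_prob W)"
    unfolding holevo_minus_discord_meas[OF Ps] len by (rule info_cong) (simp add: w)
  then have eq: "?I W = ?\<chi> - ?D Ps" by (simp add: mutual_info_eq_info[OF W])
  \<comment> \<open>Since \<open>?\<chi>\<close> does not depend on the measurement, less discord
    means more information. The information of \<open>Qs\<close> is bounded by that of its
    refinement \<open>V\<close>, and this by that of \<open>W\<close>.\<close>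
  have min: "?D Ps \<le> ?D Qs" if Qs: "projective_measurement d Qs" for Qs
  proof -
    obtain V where V: "unitary_mat d V"
      and le: "info J {..<length Qs} (\<lambda>j k. weight (Qs ! k) j) \<le> info J {..<d} (output_prob V)"
      by (rule measurement_refinement[OF Qs])
    have "?\<chi> - ?D Qs \<le> ?I V"
      using le by (simp add: holevo_minus_discord_meas[OF Qs] mutual_info_eq_info[OF V])
    then show ?thesis using max[OF V] eq by simp
  qed
  have "I_max F J A n m U p \<psi> = ?I W"
    unfolding I_max_def using W max by (intro Greatest_equality) auto
  moreover have "discord (card J) d \<rho> = ?D Ps"
    unfolding discord_def using Ps min by (intro Least_equality) auto
  moreover have "is_arg_max ?I (unitary_mat d) W"
    unfolding is_arg_max_def using W max by (auto simp: not_less)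
  moreover have "is_arg_min ?D (projective_measurement d) Ps"
    unfolding is_arg_min_def using Ps min by (auto simp: not_less)
  ultimately show ?thesis using eq by auto
qed

end
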